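(* Given a hyperedge-weighted \textsc{HyperUniqueGames} instance $\mathcal{H}(V,E,[k],\{\pi_{e,u}\}_{e\in E,u\in e},\mathcal{D}_{\mathcal{H}})$ in which every hyperedge has exactly $d$ vertices, there exists an efficient procedure which constructs a \textsc{HyperUniqueGames} instance $\mathcal{H}'(V',E',[k],\{\pi_{e,v}\}_{e\in E',v\in e},\mathcal{D}_{\mathcal{H}'})$ (again with $d$-ary hyperedges) such that \begin{itemize} \item $|V'|=O(d|V|^3|E|^3)$; \item the optimal values of $\mathcal{H}$ and $\mathcal{H}'$ differ by at most $1/|V|$, i.e. \[ \left|\max_{\sigma:V\to[k]}\Pr_{e\sim\mathcal{D}_{\mathcal{H}}}[\sigma\text{ satisfies }e]-\max_{\sigma':V'\to[k]}\Pr_{e\sim\mathcal{D}_{\mathcal{H}'}}[\sigma'\text{ satisfies }e]\right|\leq\frac{1}{|V|}; \] \item for every $v\in V'$, $\Pr_{e\sim\mathcal{D}_{\mathcal{H}'}}[v\in e]=\frac{d}{|V'|}$. \end{itemize}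
   Context: A \textsc{HyperUniqueGames} instance $\mathcal{H}(V,E,[k],\{\pi_{e,v}\},\mathcal{D})$ consists of $d$-ary hyperedges $e=(v_1,\dots,v_d)$, each with bijections $\pi_{e,v_1},\dots,\pi_{e,v_d}:[k]\to[k]$, and a probability distribution $\mathcal{D}$ on the hyperedges (the weights). A labeling $\sigma:V\to[k]$ satisfies $e$ if $\pi_{e,v_i}(\sigma(v_i))=\pi_{e,v_j}(\sigma(v_j))$ for all $i,j\in[d]$. *)

theory Defs
  imports
    "HOL-Probability.Probability"
    "HOL-Library.Log_Nat"
    "HOL-Computational_Algebra.Polynomial"
begin

section \<open>HyperUniqueGames\<close>

text \<open>A hyperedge is the tuple (list) of its vertices, so the edge set is a set of tuples. The
  label set \<open>[k]\<close> is \<open>{..<k}\<close>; \<open>perm H e v\<close> is the bijection \<open>\<pi>\<close> attached to the edge \<open>e\<close> and the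
  vertex \<open>v\<close> of \<open>e\<close>, and its values elsewhere are irrelevant.\<close>

record 'v hyper_unique_games =
  verts :: "'v set"
  edges :: "'v list set"
  num_labels :: nat
  perm :: "'v list \<Rightarrow> 'v \<Rightarrow> nat \<Rightarrow> nat"
  weight :: "'v list pmf"

definition hug_instance :: "nat \<Rightarrow> 'v hyper_unique_games \<Rightarrow> bool" where
  "hug_instance d H \<longleftrightarrow>
     0 < d \<and> 0 < num_labels H \<and> finite (verts H) \<and>
     (\<forall>e\<in>edges H. length e = d \<and> distinct e \<and> set e \<subseteq> verts H) \<and>
     (\<forall>e\<in>edges H. \<forall>v\<in>set e. bij_betw (perm H e v) {..<num_labels H} {..<num_labels H}) \<and>
     set_pmf (weight H) \<subseteq> edges H"

definition satisfies :: "'v hyper_unique_games \<Rightarrow> ('v \<Rightarrow> nat) \<Rightarrow> 'v list \<Rightarrow> bool" where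
  "satisfies H \<sigma> e \<longleftrightarrow>
     (\<forall>i<length e. \<forall>j<length e. perm H e (e ! i) (\<sigma> (e ! i)) = perm H e (e ! j) (\<sigma> (e ! j)))"

definition optimal_value :: "'v hyper_unique_games \<Rightarrow> real" where
  "optimal_value H =
     Max ((\<lambda>\<sigma>. measure_pmf.prob (weight H) {e. satisfies H \<sigma> e}) `
            (verts H \<rightarrow>\<^sub>E {..<num_labels H}))"


section \<open>A model of polynomial-time computation\<close>

text \<open>Efficiency is measured in a first-order, call-by-value functional language whose values are
  binary trees with natural numbers at the leaves. A number occupies its binary length, and every
  evaluated subexpression is charged the size of the value that it produces (logarithmic cost).
  All values held during a run are thus paid for, and the arithmetic primitives are computable in
  time polynomial in the size of their already charged operands, so this cost and the running time
  of a Turing machine are polynomially related.\<close>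

datatype val = Atom nat | Cell val val

fun vsize :: "val \<Rightarrow> nat" where
  "vsize (Atom n) = Suc (floorlog 2 n)"
| "vsize (Cell a b) = Suc (vsize a + vsize b)"

datatype arith = Add | Sub | Mul | Div | Leq

fun arith_sem :: "arith \<Rightarrow> nat \<Rightarrow> nat \<Rightarrow> nat" where
  "arith_sem Add m n = m + n"
| "arith_sem Sub m n = m - n"
| "arith_sem Mul m n = m * n"
| "arith_sem Div m n = m div n"
| "arith_sem Leq m n = (if m \<le> n then 1 else 0)"

text \<open>Variables are de Bruijn indices into the environment. \<open>Cond\<close> branches on whether its first
  argument is different from \<open>Atom 0\<close>, which also serves as the empty list. \<open>Call f\<close> runs the \<open>f\<close>-th
  function body in the environment that consists of the arguments.\<close>

datatype exp =
    Var nat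
  | Const nat
  | Arith arith exp exp
  | MkCell exp exp
  | Fst exp
  | Snd exp
  | Cond exp exp exp
  | LetIn exp exp
  | Call nat "exp list"

text \<open>\<open>eval F env e v t\<close>: with the function bodies \<open>F\<close>, the expression \<open>e\<close> evaluates to \<open>v\<close> at
  cost \<open>t\<close>. Ill-typed and diverging expressions have no value.\<close>

inductive eval :: "exp list \<Rightarrow> val list \<Rightarrow> exp \<Rightarrow> val \<Rightarrow> nat \<Rightarrow> bool"
  and evals :: "exp list \<Rightarrow> val list \<Rightarrow> exp list \<Rightarrow> val list \<Rightarrow> nat \<Rightarrow> bool"
  for F :: "exp list"
where
  Var: "i < length env \<Longrightarrow> eval F env (Var i) (env ! i) (vsize (env ! i))"
| Const: "eval F env (Const n) (Atom n) (vsize (Atom n))"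
| Arith: "eval F env a (Atom m) s \<Longrightarrow> eval F env b (Atom n) t \<Longrightarrow> r = Atom (arith_sem f m n) \<Longrightarrow>
    eval F env (Arith f a b) r (s + t + vsize r)"
| MkCell: "eval F env a v s \<Longrightarrow> eval F env b w t \<Longrightarrow>
    eval F env (MkCell a b) (Cell v w) (s + t + vsize (Cell v w))"
| Fst: "eval F env a (Cell v w) s \<Longrightarrow> eval F env (Fst a) v (s + vsize v)"
| Snd: "eval F env a (Cell v w) s \<Longrightarrow> eval F env (Snd a) w (s + vsize w)"
| Cond_True: "eval F env c u r \<Longrightarrow> u \<noteq> Atom 0 \<Longrightarrow> eval F env a v s \<Longrightarrow>
    eval F env (Cond c a b) v (r + s + vsize v)"
| Cond_False: "eval F env c (Atom 0) r \<Longrightarrow> eval F env b v s \<Longrightarrow>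
    eval F env (Cond c a b) v (r + s + vsize v)"
| LetIn: "eval F env a u s \<Longrightarrow> eval F (u # env) b v t \<Longrightarrow>
    eval F env (LetIn a b) v (s + t + vsize v)"
| Call: "evals F env as us s \<Longrightarrow> f < length F \<Longrightarrow> eval F us (F ! f) v t \<Longrightarrow>
    eval F env (Call f as) v (s + t + vsize v)"
| Nil: "evals F env [] [] 0"
| Cons: "eval F env a u s \<Longrightarrow> evals F env as us t \<Longrightarrow> evals F env (a # as) (u # us) (s + t)"


section \<open>Encoding of instances\<close>

fun list_val :: "val list \<Rightarrow> val" where
  "list_val [] = Atom 0"
| "list_val (x # xs) = Cell x (list_val xs)"

text \<open>The code of an instance consists of a listing of the vertices, the number of labels, and a
  listing of the hyperedges, each given by its vertices with the tables of their bijections and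
  by its weight, a fraction of natural numbers. An instance has several codes, and it has one only
  if all its weights are rational.\<close>

definition encodes :: "val \<Rightarrow> nat hyper_unique_games \<Rightarrow> bool" where
  "encodes x H \<longleftrightarrow>
     (\<exists>vs es num den.
        distinct vs \<and> set vs = verts H \<and> distinct es \<and> set es = edges H \<and>
        (\<forall>e\<in>edges H. 0 < den e \<and> pmf (weight H) e = real (num e) / real (den e)) \<and>
        x = Cell (list_val (map Atom vs)) (Cell (Atom (num_labels H)) (list_val
              (map (\<lambda>e. Cell
                 (list_val (map (\<lambda>v. Cell (Atom v)
                    (list_val (map (\<lambda>a. Atom (perm H e v a)) [0..<num_labels H]))) e))
                 (Cell (Atom (num e)) (Atom (den e)))) es))))"

end

(* Round the weights to multiples of 1/N with N = |V||E|, moving less than 1/|V| of the mass, so that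
   a vertex v has marginal M v / N for a natural number M v, and give v exactly M v copies. Spreading
   each edge independently over the copies of its vertices would need exponentially many edges.
   Instead all edges are coupled by a common phase r, uniform in [0,1): in phase r every vertex v is
   represented by its copy with index floor (r * M v). Each copy then has marginal 1/N, the number
   of copies is d * N, and within a phase a labeling of the copies is just a labeling of V, so the
   value of the new instance is the average over r of values of the rounded instance and the optimum
   does not change. For a fixed edge the phases fall into at most d * N intervals on which its tuple of
   copies is constant, hence the new instance can be listed in polynomial time. *)

theory Submission
  imports Defs
begin

section \<open>Splitting vertices by phases\<close>

text \<open>Rounding keeps the number of copies polynomial: weights may be irrational, or have
  denominators exponential in the size of a code, so copies in proportion to the exact marginals are
  out of reach. The resolution is dictated by the error: rounding down costs each edge less than
  1/N, hence all edges together at most |E|/N = 1/|V|. The real phase is made discrete by scaling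
  with a common multiple of all the M v, which turns every boundary k / M v into an integer. The
  price of rounding is degenerate cases: an edge may end up with mass 0 and a vertex with no copy,
  and several definitions and lemmas below guard against this. The construction never mentions a
  code, because the new instance must exist for irrational weights too; a code only decides which
  edge absorbs the lost mass. For the running time, value sizes and evaluation steps are bounded
  separately, and the cost is at most the product of the two bounds.\<close>

lemma prob_bind_pmf_of_set:
  fixes f :: "'b \<Rightarrow> 'c pmf"
  assumes "finite A" "A \<noteq> {}" "\<And>a. a \<in> A \<Longrightarrow> finite (set_pmf (f a))"
  shows "measure_pmf.prob (bind_pmf (pmf_of_set A) f) X
    = (\<Sum>a\<in>A. measure_pmf.prob (f a) X) / real (card A)"
proof -
  have "measure_pmf.prob (bind_pmf (pmf_of_set A) f) X
      = measure_pmf.expectation (bind_pmf (pmf_of_set A) f) (indicator X)"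
    by simp
  also have "\<dots> = (\<Sum>a\<in>A. measure_pmf.expectation (f a) (indicator X) /\<^sub>R real (card A))"
    using assms by (intro pmf_expectation_bind_pmf_of_set) auto
  also have "\<dots> = (\<Sum>a\<in>A. measure_pmf.prob (f a) X) / real (card A)"
    by (simp add: sum_divide_distrib field_simps)
  finally show ?thesis .
qed

text \<open>Every copy of a vertex is active in one block of \<open>w\<close> consecutive phases.
  That all blocks have the same length is what equalizes the marginals of the copies.\<close>

lemma card_div_eq:
  fixes w c n :: nat
  assumes "0 < w" "c < n"
  shows "card {r. r < n * w \<and> r div w = c} = w"
proof -
  have "{r. r < n * w \<and> r div w = c} = {c * w..<c * w + w}"
  proof (intro equalityI subsetI)
    fix r assume "r \<in> {r. r < n * w \<and> r div w = c}"
    then show "r \<in> {c * w..<c * w + w}"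
      using assms(1) by (auto simp: dividend_less_div_times add.commute)
  next
    fix r assume r: "r \<in> {c * w..<c * w + w}"
    then have "r div w = c" by (intro div_nat_eqI) (auto simp: algebra_simps)
    \<comment> \<open>Since \<open>c < n\<close>, the block with index \<open>c\<close> is not cut
      off by the end of the range.\<close>
    moreover have "c * w + w \<le> n * w"
      using mult_le_mono1[of "Suc c" n w] assms(2) by simp
    ultimately show "r \<in> {r. r < n * w \<and> r div w = c}" using r by auto
  qed
  then show ?thesis by simp
qed

text \<open>Double counting of incidences: swapping the sums counts each edge once for each of its
  \<open>d\<close> distinct vertices.\<close>

lemma sum_incident:
  fixes g :: "'a list \<Rightarrow> nat"
  assumes "finite V" "finite E" "\<And>e. e \<in> E \<Longrightarrow> length e = d \<and> distinct e \<and> set e \<subseteq> V"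
  shows "(\<Sum>v\<in>V. \<Sum>e | e \<in> E \<and> v \<in> set e. g e) = d * (\<Sum>e\<in>E. g e)"
proof -
  have "(\<Sum>v\<in>V. \<Sum>e | e \<in> E \<and> v \<in> set e. g e) = (\<Sum>v\<in>V. \<Sum>e\<in>E. if v \<in> set e then g e else 0)"
    using assms(2) by (simp add: sum.inter_filter)
  also have "\<dots> = (\<Sum>e\<in>E. \<Sum>v\<in>V. if v \<in> set e then g e else 0)"
    by (rule sum.swap)
  also have "\<dots> = (\<Sum>e\<in>E. d * g e)"
  proof (rule sum.cong)
    fix e assume e: "e \<in> E"
    have "(\<Sum>v\<in>V. if v \<in> set e then g e else 0) = (\<Sum>v\<in>{v\<in>V. v \<in> set e}. g e)"
      using assms(1) by (rule sum.inter_filter[symmetric])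
    also have "{v\<in>V. v \<in> set e} = set e" using assms(3)[OF e] by auto
    finally show "(\<Sum>v\<in>V. if v \<in> set e then g e else 0) = d * g e"
      using assms(3)[OF e] by (simp add: distinct_card)
  qed simp
  finally show ?thesis by (simp add: sum_distrib_left)
qed

locale regularization =
  fixes d :: nat and H :: "nat hyper_unique_games" and e0 :: "nat list"
  assumes inst: "hug_instance d H" and e0: "e0 \<in> edges H"
begin

definition grid :: nat where
  "grid = card (verts H) * card (edges H)"

definition rounded_down :: "nat list \<Rightarrow> nat" where
  "rounded_down e = nat \<lfloor>pmf (weight H) e * real grid\<rfloor>"

text \<open>The edge \<open>e0\<close> absorbs the mass lost by rounding down. In the code of an instance it is the
  last one, so that the program can pass the remaining mass along the list.\<close>

definition share :: "nat list \<Rightarrow> nat" where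
  "share e = (if e = e0 then grid - (\<Sum>f\<in>edges H - {e0}. rounded_down f) else rounded_down e)"

definition num_copies :: "nat \<Rightarrow> nat" where
  "num_copies v = (\<Sum>e | e \<in> edges H \<and> v \<in> set e. share e)"

text \<open>Every \<open>num_copies v\<close> is at most \<open>grid\<close> and hence divides \<open>fact grid\<close>: the factorial is a common
  time scale with only polynomially many digits.\<close>

definition period :: nat where
  "period = fact grid"

text \<open>The copy of \<open>v\<close> that is active in phase \<open>r\<close> is \<open>r div width v\<close>; a vertex without copies gets width
  \<open>0\<close>, and then the junk value \<open>r div 0 = 0\<close> still makes \<open>copy v r div grid = v\<close> true.\<close>

definition width :: "nat \<Rightarrow> nat" where
  "width v = period div num_copies v"

text \<open>A vertex and an index below \<open>grid\<close> are packed into one number, to be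
  unpacked by \<open>div\<close> and \<open>mod\<close>. The base is \<open>grid\<close> because it
  exceeds the copy indices of every vertex at once.\<close>

definition copy :: "nat \<Rightarrow> nat \<Rightarrow> nat" where
  "copy v r = v * grid + r div width v"

definition lift :: "nat list \<Rightarrow> nat \<Rightarrow> nat list" where
  "lift e r = map (\<lambda>v. copy v r) e"

definition share_pmf :: "nat list pmf" where
  "share_pmf = embed_pmf (\<lambda>e. if e \<in> edges H then real (share e) / real grid else 0)"

definition new_weight :: "nat list pmf" where
  "new_weight = bind_pmf (pmf_of_set {..<period}) (\<lambda>r. map_pmf (\<lambda>e. lift e r) share_pmf)"

text \<open>Taking the support as edge set discards the edges of share 0, whose vertices may have no
  copies. Division by \<open>grid\<close> recovers the original edge from a lifted one, so the
  bijections can be inherited.\<close>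

definition regular :: "nat hyper_unique_games" where
  "regular = \<lparr>verts = (\<Union>v\<in>verts H. (\<lambda>c. v * grid + c) ` {..<num_copies v}),
     edges = set_pmf new_weight,
     num_labels = num_labels H,
     perm = (\<lambda>e v. perm H (map (\<lambda>u. u div grid) e) (v div grid)),
     weight = new_weight\<rparr>"

section \<open>Rounded shares, widths and slots\<close>

lemma edge: "e \<in> edges H \<Longrightarrow> length e = d \<and> distinct e \<and> set e \<subseteq> verts H"
  and finite_verts: "finite (verts H)"
  and d_pos: "0 < d"
  and perm_bij: "e \<in> edges H \<Longrightarrow> v \<in> set e \<Longrightarrow>
    bij_betw (perm H e v) {..<num_labels H} {..<num_labels H}"
  and set_weight: "set_pmf (weight H) \<subseteq> edges H"
  and labels_pos: "0 < num_labels H"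
  using inst by (auto simp: hug_instance_def)

lemma finite_edges: "finite (edges H)"
  by (rule finite_subset[OF _ finite_lists_length_eq[OF finite_verts, of d]]) (use edge in auto)

lemma card_verts_pos: "0 < card (verts H)"
  using edge[OF e0] d_pos finite_verts by (metis bot.extremum_uniqueI card_gt_0_iff length_0_conv
      list.set_intros(1) neq_Nil_conv not_less_zero set_empty)

lemma card_edges_pos: "0 < card (edges H)"
  using e0 finite_edges by (auto simp: card_gt_0_iff)

lemma grid_pos: "0 < grid"
  using card_verts_pos card_edges_pos by (simp add: grid_def)

lemma period_pos: "0 < period"
  by (simp add: period_def)

lemma sum_weight: "(\<Sum>e\<in>edges H. pmf (weight H) e) = 1"
  using set_weight finite_edges by (intro sum_pmf_eq_1) auto

lemma rounded_down_le: "real (rounded_down e) \<le> pmf (weight H) e * real grid"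
  unfolding rounded_down_def by (simp add: of_nat_nat)

lemma rounded_down_gt: "pmf (weight H) e * real grid - 1 < real (rounded_down e)"
  unfolding rounded_down_def by (simp add: of_nat_nat)

lemma sum_rounded_down_le: "(\<Sum>e\<in>edges H. rounded_down e) \<le> grid"
proof -
  have "real (\<Sum>e\<in>edges H. rounded_down e) \<le> (\<Sum>e\<in>edges H. pmf (weight H) e * real grid)"
    unfolding of_nat_sum by (rule sum_mono) (rule rounded_down_le)
  also have "\<dots> = real grid"
    using sum_weight by (simp flip: sum_distrib_right)
  finally show ?thesis by (simp only: of_nat_le_iff)
qed

text \<open>The truncated subtraction in the share of \<open>e0\<close> is exact, because the
  amounts rounded down add up to at most \<open>grid\<close>.\<close>

lemma sum_share: "(\<Sum>e\<in>edges H. share e) = grid"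
proof -
  have "(\<Sum>f\<in>edges H - {e0}. rounded_down f) \<le> grid"
    using sum_rounded_down_le sum_mono2[of "edges H" "edges H - {e0}" rounded_down] finite_edges
    by (auto intro: order_trans)
  moreover have "(\<Sum>e\<in>edges H - {e0}. share e) = (\<Sum>f\<in>edges H - {e0}. rounded_down f)"
    by (rule sum.cong) (auto simp: share_def)
  ultimately show ?thesis
    using sum.remove[OF finite_edges e0, of share] by (simp add: share_def)
qed

lemma num_copies_le_grid: "num_copies v \<le> grid"
  unfolding num_copies_def sum_share[symmetric]
  using finite_edges by (intro sum_mono2) auto

lemma num_copies_pos: "e \<in> edges H \<Longrightarrow> v \<in> set e \<Longrightarrow> 0 < share e \<Longrightarrow> 0 < num_copies v"
  unfolding num_copies_def using finite_edges by (intro sum_pos2[where i = e]) auto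

lemma num_copies_width:
  assumes "0 < num_copies v"
  shows "num_copies v * width v = period"
  unfolding width_def period_def using assms num_copies_le_grid
  by (intro dvd_mult_div_cancel dvd_fact) auto

lemma width_pos: "0 < num_copies v \<Longrightarrow> 0 < width v"
  using num_copies_width period_pos by (metis mult_0_right neq0_conv)

lemma slot_less: "0 < num_copies v \<Longrightarrow> r < period \<Longrightarrow> r div width v < num_copies v"
  using num_copies_width[of v] width_pos[of v] by (simp add: less_mult_imp_div_less)

lemma slot_less_grid: "r < period \<Longrightarrow> r div width v < grid"
proof (cases "num_copies v = 0")
  case True then show ?thesis using grid_pos by (simp add: width_def)
next
  case False
  then show "r < period \<Longrightarrow> r div width v < grid"
    using slot_less[of v r] num_copies_le_grid[of v] by simp
qed

lemma copy_div: "r < period \<Longrightarrow> copy v r div grid = v"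
  using slot_less_grid[of r v] grid_pos by (simp add: copy_def div_nat_eqI)

lemma copy_mod: "r < period \<Longrightarrow> copy v r mod grid = r div width v"
  using slot_less_grid[of r v] by (simp add: copy_def)

lemma map_div_lift: "r < period \<Longrightarrow> map (\<lambda>u. u div grid) (lift e r) = e"
  by (simp add: lift_def copy_div map_idI)

section \<open>Probabilities of edges before and after lifting\<close>

lemma pmf_share: "pmf share_pmf e = (if e \<in> edges H then real (share e) / real grid else 0)"
  unfolding share_pmf_def
proof (rule pmf_embed_pmf)
  let ?f = "\<lambda>e. if e \<in> edges H then real (share e) / real grid else 0"
  have "(\<integral>\<^sup>+ e. ennreal (?f e) \<partial>count_space UNIV) = (\<Sum>e\<in>edges H. ennreal (?f e))"
    using finite_edges by (intro nn_integral_count_space') auto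
  also have "\<dots> = ennreal (\<Sum>e\<in>edges H. ?f e)"
    by (intro sum_ennreal) simp
  also have "(\<Sum>e\<in>edges H. ?f e) = 1"
    using sum_share grid_pos by (simp flip: sum_divide_distrib of_nat_sum)
  finally show "(\<integral>\<^sup>+ e. ennreal (?f e) \<partial>count_space UNIV) = 1" by simp
qed simp

lemma set_share: "set_pmf share_pmf = {e \<in> edges H. 0 < share e}"
  using grid_pos by (auto simp: set_pmf_iff pmf_share split: if_splits)

lemma set_new_weight: "set_pmf new_weight = {lift e r | e r. e \<in> edges H \<and> 0 < share e \<and> r < period}"
proof -
  have "set_pmf (pmf_of_set {..<period}) = {..<period}"
    using period_pos by (intro set_pmf_of_set) auto
  then show ?thesis
    unfolding new_weight_def by (auto simp: set_bind_pmf set_share)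
qed

lemma prob_share:
  "measure_pmf.prob share_pmf A = (\<Sum>e | e \<in> edges H \<and> e \<in> A. real (share e)) / real grid"
proof -
  have "measure_pmf.prob share_pmf A = measure_pmf.prob share_pmf {e. e \<in> edges H \<and> e \<in> A}"
    by (rule measure_pmf.finite_measure_eq_AE) (auto simp: AE_measure_pmf_iff set_share)
  also have "\<dots> = (\<Sum>e | e \<in> edges H \<and> e \<in> A. pmf share_pmf e)"
    using finite_edges by (intro measure_measure_pmf_finite) auto
  finally show ?thesis by (simp add: pmf_share sum_divide_distrib)
qed

lemma prob_new_weight:
  "measure_pmf.prob new_weight X
    = (\<Sum>r<period. measure_pmf.prob share_pmf {e. lift e r \<in> X}) / real period"
  unfolding new_weight_def using period_pos finite_edges
  by (subst prob_bind_pmf_of_set) (auto simp: vimage_def set_share)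

text \<open>A lifted edge determines its original edge, so lifts of different edges never collide,
  not even across phases. Only the phases in which \<open>e\<close> itself uses the same copies
  contribute. The common denominator \<open>grid * period\<close> is the one written into the
  code.\<close>

lemma pmf_new_weight:
  assumes "e \<in> edges H" "q < period"
  shows "pmf new_weight (lift e q)
    = real (share e * card {r. r < period \<and> lift e r = lift e q}) / real (grid * period)"
proof -
  have eq: "lift f r = lift e q \<longleftrightarrow> f = e \<and> lift e r = lift e q" if "r < period" for f r
    using map_div_lift[OF that, of f] map_div_lift[OF assms(2), of e] by metis
  have "pmf new_weight (lift e q)
      = (\<Sum>r<period. measure_pmf.prob share_pmf {f. lift f r = lift e q}) / real period"
    using prob_new_weight[of "{lift e q}"] by (simp add: measure_pmf_single)
  also have "(\<Sum>r<period. measure_pmf.prob share_pmf {f. lift f r = lift e q})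
      = (\<Sum>r<period. if lift e r = lift e q then real (share e) / real grid else 0)"
  proof (rule sum.cong)
    fix r assume "r \<in> {..<period}"
    then have "{f. lift f r = lift e q} = {f. f = e \<and> lift e r = lift e q}"
      by (intro Collect_cong eq) simp
    then show "measure_pmf.prob share_pmf {f. lift f r = lift e q}
        = (if lift e r = lift e q then real (share e) / real grid else 0)"
      using assms(1) by (cases "lift e r = lift e q") (simp_all add: measure_pmf_single pmf_share)
  qed simp
  also have "\<dots> = real (card {r. r < period \<and> lift e r = lift e q}) * (real (share e) / real grid)"
    by (simp add: sum.If_cases Int_def)
  finally show ?thesis by simp
qed

text \<open>Copy indices stay below \<open>grid\<close>, so the copies of different vertices are
  disjoint. Double counting then gives \<open>d\<close> times the total share, which is
  \<open>grid\<close>.\<close>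

lemma card_copies: "card (verts regular) = d * grid"
proof -
  have "card (verts regular) = (\<Sum>v\<in>verts H. card ((\<lambda>c. v * grid + c) ` {..<num_copies v}))"
    unfolding regular_def hyper_unique_games.simps
  proof (intro card_UN_disjoint finite_verts ballI impI)
    fix v w :: nat assume "v \<noteq> w"
    have div: "x div grid = u" if x: "x \<in> (\<lambda>c. u * grid + c) ` {..<num_copies u}" for x u
    proof -
      obtain c where c: "c < num_copies u" "x = u * grid + c" using x by auto
      then have "c < grid" using num_copies_le_grid[of u] by simp
      with c show ?thesis by (simp add: div_nat_eqI)
    qed
    show "(\<lambda>c. v * grid + c) ` {..<num_copies v} \<inter> (\<lambda>c. w * grid + c) ` {..<num_copies w} = {}"
      unfolding disjoint_iff using div[of _ v] div[of _ w] \<open>v \<noteq> w\<close> by metis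
  qed auto
  also have "\<dots> = (\<Sum>v\<in>verts H. num_copies v)"
    by (intro sum.cong) (auto simp: card_image inj_on_def)
  also have "\<dots> = d * grid"
    unfolding num_copies_def using sum_incident[OF finite_verts finite_edges edge, of share]
    by (simp add: sum_share)
  finally show ?thesis .
qed

text \<open>A copy of \<open>v\<close> is active in a fraction 1 / \<open>num_copies v\<close> of
  the phases, and in each of these the edges through \<open>v\<close> have mass
  \<open>num_copies v\<close> / \<open>grid\<close>. The product 1 / \<open>grid\<close> no longer
  depends on \<open>v\<close>, and it equals \<open>d\<close> / (\<open>d * grid\<close>).\<close>

lemma degree_regular:
  assumes "x \<in> verts regular"
  shows "measure_pmf.prob (weight regular) {e. x \<in> set e} = real d / real (card (verts regular))"
proof -
  obtain v c where v: "v \<in> verts H" "c < num_copies v" and x: "x = v * grid + c"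
    using assms by (auto simp: regular_def)
  have pos: "0 < num_copies v" using v by simp
  have c: "c < grid" using v num_copies_le_grid[of v] by simp
  have inlift: "x \<in> set (lift e r) \<longleftrightarrow> v \<in> set e \<and> r div width v = c" if "r < period" for e r
  proof -
    have "copy u r = x \<longleftrightarrow> u = v \<and> r div width v = c" for u
    proof
      assume "copy u r = x"
      then have "copy u r div grid = x div grid" "copy u r mod grid = x mod grid" by auto
      then show "u = v \<and> r div width v = c"
        using copy_div[OF that, of u] copy_mod[OF that, of u] c x by auto
    qed (simp add: copy_def x)
    then show ?thesis unfolding lift_def set_map image_iff by metis
  qed
  have "measure_pmf.prob share_pmf {e. x \<in> set (lift e r)}
      = (if r div width v = c then real (num_copies v) / real grid else 0)" if "r < period" for r
  proof -
    have eq: "{e \<in> edges H. x \<in> set (lift e r)} = {e \<in> edges H. v \<in> set e \<and> r div width v = c}"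
      using inlift[OF that] by blast
    show ?thesis
      unfolding prob_share mem_Collect_eq eq by (simp add: num_copies_def)
  qed
  then have "(\<Sum>r<period. measure_pmf.prob share_pmf {e. x \<in> set (lift e r)})
      = (\<Sum>r<period. if r div width v = c then real (num_copies v) / real grid else 0)"
    by (intro sum.cong) auto
  then have "measure_pmf.prob new_weight {e. x \<in> set e}
      = (\<Sum>r<period. if r div width v = c then real (num_copies v) / real grid else 0) / real period"
    by (simp add: prob_new_weight)
  also have "\<dots> = real (card {r. r < num_copies v * width v \<and> r div width v = c})
      * (real (num_copies v) / real grid) / real period"
    using num_copies_width[OF pos] by (simp add: sum.If_cases Int_def)
  also have "\<dots> = real (num_copies v * width v) / (real grid * real period)"
    using card_div_eq[OF width_pos[OF pos] v(2)] by simp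
  also have "\<dots> = 1 / real grid"
    using num_copies_width[OF pos] period_pos by simp
  finally show ?thesis
    unfolding card_copies using d_pos by (simp add: regular_def)
qed

lemma satisfies_lift:
  assumes "r < period"
  shows "satisfies regular \<sigma> (lift e r) \<longleftrightarrow> satisfies H (\<lambda>v. \<sigma> (copy v r)) e"
proof -
  have "perm regular (lift e r) (lift e r ! i) (\<sigma> (lift e r ! i))
      = perm H e (e ! i) (\<sigma> (copy (e ! i) r))" if "i < length e" for i
    using that copy_div[OF assms] map_div_lift[OF assms] by (simp add: regular_def lift_def)
  moreover have "length (lift e r) = length e" by (simp add: lift_def)
  ultimately show ?thesis by (simp add: satisfies_def)
qed

lemma instance_regular: "hug_instance d regular"
proof -
  have "length x = d \<and> distinct x \<and> set x \<subseteq> verts regular" if "x \<in> edges regular" for x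
  proof -
    obtain e r where e: "e \<in> edges H" "0 < share e" "r < period" and x: "x = lift e r"
      using \<open>x \<in> edges regular\<close> by (auto simp: regular_def set_new_weight)
    have "inj_on (\<lambda>v. copy v r) (set e)"
      using copy_div[OF e(3)] by (metis inj_onI)
    then have "distinct x" using edge[OF e(1)] by (simp add: x lift_def distinct_map)
    \<comment> \<open>Positivity of the share matters here: it gives every vertex of
      \<open>e\<close> a copy, so that its slot is a valid index.\<close>
    moreover have "copy v r \<in> verts regular" if "v \<in> set e" for v
      using that edge[OF e(1)] slot_less[OF num_copies_pos[OF e(1) that e(2)] e(3)]
      by (auto simp: regular_def copy_def)
    ultimately show ?thesis using edge[OF e(1)] by (auto simp: x lift_def)
  qed
  moreover have "bij_betw (perm regular x u) {..<num_labels regular} {..<num_labels regular}"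
    if x_edge: "x \<in> edges regular" and u: "u \<in> set x" for x u
  proof -
    obtain e r where e: "e \<in> edges H" "r < period" and x: "x = lift e r"
      using x_edge by (auto simp: regular_def set_new_weight)
    obtain v where v: "v \<in> set e" "u = copy v r" using u by (auto simp: x lift_def)
    then have "perm regular x u = perm H e v"
      using copy_div[OF e(2)] map_div_lift[OF e(2), of e] by (simp add: regular_def x)
    then show ?thesis using perm_bij[OF e(1) v(1)] by (simp add: regular_def)
  qed
  moreover have "finite (verts regular)" using finite_verts by (simp add: regular_def)
  ultimately show ?thesis
    using d_pos labels_pos by (auto simp: hug_instance_def regular_def)
qed

text \<open>The value of a labeling in the rounded instance, which is not formed as an instance of
  its own.\<close>

definition share_value :: "(nat \<Rightarrow> nat) \<Rightarrow> real" where
  "share_value \<sigma> = measure_pmf.prob share_pmf {e. satisfies H \<sigma> e}"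

lemma prob_satisfies_regular:
  "measure_pmf.prob (weight regular) {e. satisfies regular \<sigma> e}
    = (\<Sum>r<period. share_value (\<lambda>v. \<sigma> (copy v r))) / real period"
proof -
  have "measure_pmf.prob (weight regular) {e. satisfies regular \<sigma> e}
     = (\<Sum>r<period. measure_pmf.prob share_pmf {e. satisfies regular \<sigma> (lift e r)}) / real period"
    using prob_new_weight by (simp add: regular_def)
  then show ?thesis by (simp add: share_value_def satisfies_lift)
qed

text \<open>Labels may be changed freely off the edges of positive share. This absorbs the vertices
  without copies, for which a labeling of the copies provides no meaningful label.\<close>

lemma share_value_cong:
  assumes "\<And>e v. e \<in> edges H \<Longrightarrow> 0 < share e \<Longrightarrow> v \<in> set e \<Longrightarrow> \<sigma> v = \<tau> v"
  shows "share_value \<sigma> = share_value \<tau>"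
  unfolding share_value_def
proof (rule measure_pmf.finite_measure_eq_AE)
  have "satisfies H \<sigma> e = satisfies H \<tau> e" if "e \<in> edges H" "0 < share e" for e
    using assms[OF that] by (simp add: satisfies_def)
  then show "AE e in measure_pmf share_pmf. (e \<in> {e. satisfies H \<sigma> e}) = (e \<in> {e. satisfies H \<tau> e})"
    by (auto simp: AE_measure_pmf_iff set_share)
qed auto

text \<open>Every edge other than \<open>e0\<close> loses less than 1 / \<open>grid\<close>, and
  \<open>e0\<close> gains exactly the sum \<open>D\<close> of these losses. A set of edges avoiding
  \<open>e0\<close> therefore loses between 0 and \<open>D\<close>, and one containing
  \<open>e0\<close> gains between 0 and \<open>D\<close>; so the error is \<open>D\<close> and not
  twice that.\<close>

lemma share_value_close:
  "\<bar>measure_pmf.prob (weight H) {e. satisfies H \<sigma> e} - share_value \<sigma>\<bar> \<le> 1 / real (card (verts H))"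
proof -
  let ?S = "{e \<in> edges H. satisfies H \<sigma> e}"
  let ?w = "pmf (weight H)" and ?s = "\<lambda>e. real (share e) / real grid"
  define D where "D = (\<Sum>e\<in>edges H - {e0}. ?w e - ?s e)"
  have prob: "measure_pmf.prob (weight H) {e. satisfies H \<sigma> e} = (\<Sum>e\<in>?S. ?w e)"
  proof -
    have "measure_pmf.prob (weight H) {e. satisfies H \<sigma> e} = measure_pmf.prob (weight H) ?S"
      using set_weight by (intro measure_pmf.finite_measure_eq_AE) (auto simp: AE_measure_pmf_iff)
    then show ?thesis using finite_edges by (simp add: measure_measure_pmf_finite)
  qed
  have nonneg: "0 \<le> ?w e - ?s e" and upper: "?w e - ?s e \<le> 1 / real grid" if "e \<noteq> e0" for e
    using that rounded_down_le[of e] rounded_down_gt[of e] grid_pos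
    by (simp_all add: share_def pos_le_divide_eq pos_divide_le_eq diff_le_eq flip: add_divide_distrib)
  have total: "(?w e0 - ?s e0) + D = 0"
  proof -
    have "(\<Sum>e\<in>edges H. ?w e - ?s e) = 0"
      using sum_weight sum_share grid_pos
      by (simp add: sum_subtractf flip: sum_divide_distrib of_nat_sum)
    then show ?thesis
      using sum.remove[OF finite_edges e0, of "\<lambda>e. ?w e - ?s e"] by (simp add: D_def)
  qed
  have D_le: "D \<le> 1 / real (card (verts H))"
  proof -
    have "D \<le> (\<Sum>e\<in>edges H - {e0}. 1 / real grid)"
      unfolding D_def by (rule sum_mono) (use upper in auto)
    also have "\<dots> \<le> (\<Sum>e\<in>edges H. 1 / real grid)"
      using finite_edges by (intro sum_mono2) auto
    also have "\<dots> = 1 / real (card (verts H))"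
      using card_edges_pos by (simp add: grid_def)
    finally show ?thesis .
  qed
  have part: "0 \<le> (\<Sum>e\<in>?S - {e0}. ?w e - ?s e)" "(\<Sum>e\<in>?S - {e0}. ?w e - ?s e) \<le> D"
    unfolding D_def by (intro sum_nonneg sum_mono2 nonneg; use finite_edges in auto)+
  have fin: "finite ?S" using finite_edges by simp
  have "(\<Sum>e\<in>?S. ?w e - ?s e)
      = (\<Sum>e\<in>?S - {e0}. ?w e - ?s e) + (if e0 \<in> ?S then ?w e0 - ?s e0 else 0)"
  proof (cases "e0 \<in> ?S")
    case True
    then show ?thesis using sum.remove[OF fin True] by (simp only: if_True add.commute)
  next
    case False
    then have "?S - {e0} = ?S" by blast
    with False show ?thesis by (simp only: if_False add_0_right)
  qed
  then have "\<bar>\<Sum>e\<in>?S. ?w e - ?s e\<bar> \<le> D"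
    using part total by (cases "e0 \<in> ?S"; simp only: if_True if_False; linarith)
  moreover have "measure_pmf.prob (weight H) {e. satisfies H \<sigma> e} - share_value \<sigma>
      = (\<Sum>e\<in>?S. ?w e - ?s e)"
    unfolding prob share_value_def prob_share
    by (simp add: sum_subtractf sum_divide_distrib)
  ultimately show ?thesis using D_le by linarith
qed

section \<open>Comparison of the optimal values\<close>

lemma optimal_value_ge:
  assumes "hug_instance d' G" "\<sigma> \<in> verts G \<rightarrow>\<^sub>E {..<num_labels G}"
  shows "measure_pmf.prob (weight G) {e. satisfies G \<sigma> e} \<le> optimal_value G"
  unfolding optimal_value_def using assms
  by (intro Max_ge) (auto simp: hug_instance_def intro!: finite_PiE)

lemma optimal_value_attained:
  assumes "hug_instance d' G"
  obtains \<sigma> where "\<sigma> \<in> verts G \<rightarrow>\<^sub>E {..<num_labels G}"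
    "optimal_value G = measure_pmf.prob (weight G) {e. satisfies G \<sigma> e}"
proof -
  have "optimal_value G \<in> (\<lambda>\<sigma>. measure_pmf.prob (weight G) {e. satisfies G \<sigma> e}) `
      (verts G \<rightarrow>\<^sub>E {..<num_labels G})"
    unfolding optimal_value_def using assms
    by (intro Max_in) (auto simp: hug_instance_def PiE_eq_empty_iff intro!: finite_PiE)
  then show ?thesis using that by auto
qed

text \<open>All copies of a vertex receive its label. Every phase then sees the same labeling of the
  original vertices, so the average over the phases is a constant.\<close>

lemma optimal_value_regular_ge:
  "optimal_value H - 1 / real (card (verts H)) \<le> optimal_value regular"
proof -
  obtain \<sigma> where \<sigma>: "\<sigma> \<in> verts H \<rightarrow>\<^sub>E {..<num_labels H}"
    "optimal_value H = measure_pmf.prob (weight H) {e. satisfies H \<sigma> e}"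
    using optimal_value_attained[OF inst] .
  define \<tau> where "\<tau> = restrict (\<lambda>x. \<sigma> (x div grid)) (verts regular)"
  have \<tau>: "\<tau> \<in> verts regular \<rightarrow>\<^sub>E {..<num_labels regular}"
  proof -
    have "x div grid \<in> verts H" if x: "x \<in> verts regular" for x
    proof -
      obtain v c where "v \<in> verts H" "c < num_copies v" "x = v * grid + c"
        using x by (auto simp: regular_def)
      then show ?thesis using num_copies_le_grid[of v] by (simp add: div_nat_eqI)
    qed
    then show ?thesis using \<sigma>(1) by (auto simp: \<tau>_def regular_def PiE_iff)
  qed
  have "share_value (\<lambda>v. \<tau> (copy v r)) = share_value \<sigma>" if "r < period" for r
  proof (rule share_value_cong)
    fix e v assume e: "e \<in> edges H" "0 < share e" "v \<in> set e"
    then have "copy v r \<in> verts regular"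
      using edge[OF e(1)] slot_less[OF num_copies_pos[OF e(1,3,2)] that]
      by (auto simp: regular_def copy_def)
    then show "\<tau> (copy v r) = \<sigma> v" by (simp add: \<tau>_def copy_div[OF that])
  qed
  then have "share_value \<sigma> = measure_pmf.prob (weight regular) {e. satisfies regular \<tau> e}"
    using period_pos by (simp add: prob_satisfies_regular)
  also have "\<dots> \<le> optimal_value regular"
    by (rule optimal_value_ge[OF instance_regular \<tau>])
  finally show ?thesis using share_value_close[of \<sigma>] \<sigma>(2) by linarith
qed

text \<open>An optimal labeling of the copies induces a labeling of the original vertices in each
  phase. None of these beats the optimum by more than the rounding error, hence neither does their
  average.\<close>

lemma optimal_value_regular_le:
  "optimal_value regular \<le> optimal_value H + 1 / real (card (verts H))"
proof -
  obtain \<tau> where \<tau>: "\<tau> \<in> verts regular \<rightarrow>\<^sub>E {..<num_labels regular}"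
    "optimal_value regular = measure_pmf.prob (weight regular) {e. satisfies regular \<tau> e}"
    using optimal_value_attained[OF instance_regular] .
  have phase: "share_value (\<lambda>v. \<tau> (copy v r)) \<le> optimal_value H + 1 / real (card (verts H))"
    if r: "r < period" for r
  proof -
    \<comment> \<open>The default 0 is a legal label, and a vertex that receives it by default lies
      on no edge of positive share.\<close>
    define \<sigma> where "\<sigma> = restrict (\<lambda>v. if 0 < num_copies v then \<tau> (copy v r) else 0) (verts H)"
    have "\<tau> (copy v r) < num_labels H" if "v \<in> verts H" "0 < num_copies v" for v
    proof -
      have "copy v r \<in> verts regular"
        using that slot_less[OF that(2) r] by (auto simp: regular_def copy_def)
      then show ?thesis using \<tau>(1) by (auto simp: regular_def)
    qed
    then have \<sigma>: "\<sigma> \<in> verts H \<rightarrow>\<^sub>E {..<num_labels H}"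
      using labels_pos by (auto simp: \<sigma>_def)
    have "share_value (\<lambda>v. \<tau> (copy v r)) = share_value \<sigma>"
      by (rule share_value_cong) (use num_copies_pos edge in \<open>auto simp: \<sigma>_def\<close>)
    then show ?thesis
      using share_value_close[of \<sigma>] optimal_value_ge[OF inst \<sigma>] by linarith
  qed
  have "optimal_value regular = (\<Sum>r<period. share_value (\<lambda>v. \<tau> (copy v r))) / real period"
    unfolding \<tau>(2) by (rule prob_satisfies_regular)
  also have "\<dots> \<le> (\<Sum>r<period. optimal_value H + 1 / real (card (verts H))) / real period"
    by (intro divide_right_mono sum_mono) (use phase in auto)
  also have "\<dots> = optimal_value H + 1 / real (card (verts H))"
    using period_pos by simp
  finally show ?thesis .
qed

end

section \<open>Cost accounting\<close>

text \<open>If no value held during a run is larger than \<open>S\<close>, then \<open>n\<close> evaluation steps cost at most \<open>n * S\<close>.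
  Values obtained by projection, branching, truncated subtraction or division are no larger than
  what they come from, and a comparison yields a value of size at most \<open>2\<close>, so only \<open>Const\<close>, \<open>MkCell\<close>, \<open>Add\<close> and \<open>Mul\<close> need an explicit size check
  below.\<close>

definition calls :: "exp list \<Rightarrow> nat \<Rightarrow> nat \<Rightarrow> val list \<Rightarrow> val \<Rightarrow> nat \<Rightarrow> bool" where
  "calls F S f us v n \<longleftrightarrow> f < length F \<and>
     ((\<forall>u\<in>set us. vsize u \<le> S) \<longrightarrow> vsize v \<le> S \<and> (\<exists>t\<le>n * S. eval F us (F ! f) v t))"

text \<open>\<open>with_call\<close> is a constant so that the simplifier leaves calls alone until the specification of
  the called function is applied.\<close>

definition with_call ::
  "exp list \<Rightarrow> nat \<Rightarrow> nat \<Rightarrow> val list \<Rightarrow> (val \<Rightarrow> nat \<Rightarrow> bool) \<Rightarrow> bool" where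
  "with_call F S f us Q \<longleftrightarrow> (\<exists>v n. calls F S f us v n \<and> Q v n)"

text \<open>A weakest precondition: \<open>Q\<close> receives the value together with the number of
  evaluation steps. Calls are not unfolded but refer to a specification of the callee, so recursion
  of the program is left to inductions over its data.\<close>

fun wp :: "exp list \<Rightarrow> nat \<Rightarrow> val list \<Rightarrow> exp \<Rightarrow> (val \<Rightarrow> nat \<Rightarrow> bool) \<Rightarrow> bool"
  and wps :: "exp list \<Rightarrow> nat \<Rightarrow> val list \<Rightarrow> exp list \<Rightarrow> (val list \<Rightarrow> nat \<Rightarrow> bool) \<Rightarrow> bool"
where
  "wp F S env (Var i) Q \<longleftrightarrow> i < length env \<and> Q (env ! i) 1"
| "wp F S env (Const c) Q \<longleftrightarrow> vsize (Atom c) \<le> S \<and> Q (Atom c) 1"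
| "wp F S env (Arith f a b) Q \<longleftrightarrow> wp F S env a (\<lambda>u s. wp F S env b (\<lambda>w t.
     \<exists>m n. u = Atom m \<and> w = Atom n \<and>
       (f = Add \<or> f = Mul \<longrightarrow> vsize (Atom (arith_sem f m n)) \<le> S) \<and>
       Q (Atom (arith_sem f m n)) (Suc (s + t))))"
| "wp F S env (MkCell a b) Q \<longleftrightarrow> wp F S env a (\<lambda>u s. wp F S env b (\<lambda>w t.
     vsize (Cell u w) \<le> S \<and> Q (Cell u w) (Suc (s + t))))"
| "wp F S env (Fst a) Q \<longleftrightarrow> wp F S env a (\<lambda>u s. \<exists>x y. u = Cell x y \<and> Q x (Suc s))"
| "wp F S env (Snd a) Q \<longleftrightarrow> wp F S env a (\<lambda>u s. \<exists>x y. u = Cell x y \<and> Q y (Suc s))"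
| "wp F S env (Cond c a b) Q \<longleftrightarrow> wp F S env c (\<lambda>u r.
     (u \<noteq> Atom 0 \<longrightarrow> wp F S env a (\<lambda>v s. Q v (Suc (r + s)))) \<and>
     (u = Atom 0 \<longrightarrow> wp F S env b (\<lambda>v s. Q v (Suc (r + s)))))"
| "wp F S env (LetIn a b) Q \<longleftrightarrow> wp F S env a (\<lambda>u s.
     wp F S (u # env) b (\<lambda>v t. Q v (Suc (s + t))))"
| "wp F S env (Call f as) Q \<longleftrightarrow> wps F S env as (\<lambda>us s.
     with_call F S f us (\<lambda>v n. Q v (Suc (s + n))))"
| "wps F S env [] Q \<longleftrightarrow> Q [] 0"
| "wps F S env (a # as) Q \<longleftrightarrow> wp F S env a (\<lambda>u s. wps F S env as (\<lambda>us t. Q (u # us) (s + t)))"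

section \<open>Soundness of the step counts\<close>

lemma vsize_arith:
  assumes "2 \<le> S" "vsize (Atom m) \<le> S" "vsize (Atom n) \<le> S"
    "f = Add \<or> f = Mul \<longrightarrow> vsize (Atom (arith_sem f m n)) \<le> S"
  shows "vsize (Atom (arith_sem f m n)) \<le> S"
proof -
  have le: "vsize (Atom k) \<le> S" if "k \<le> m" for k
    using that assms(2) floorlog_mono[of k m 2] by simp
  have "vsize (Atom 0) \<le> S" "vsize (Atom 1) \<le> S"
    using assms(1) floorlog_leI[of 0 2 0] floorlog_leI[of 1 2 1] by simp_all
  then show ?thesis using assms(4) le[of "m - n"] le[of "m div n"] by (cases f) auto
qed

text \<open>Soundness for the single arguments is a premise, because this is applied inside the
  induction of \<open>wp_sound\<close>, where it is available only as induction hypothesis.\<close>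

lemma wps_sound:
  assumes "\<And>a Q. a \<in> set as \<Longrightarrow> wp F S env a Q \<Longrightarrow>
      \<exists>v n t. Q v n \<and> vsize v \<le> S \<and> t \<le> n * S \<and> eval F env a v t"
    and "wps F S env as Q"
  shows "\<exists>vs n t. Q vs n \<and> (\<forall>v\<in>set vs. vsize v \<le> S) \<and> t \<le> n * S \<and> evals F env as vs t"
  using assms
proof (induction as arbitrary: Q)
  case Nil
  then show ?case by (force intro: eval_evals.Nil)
next
  case (Cons a as)
  from Cons.prems(2) have
    "wp F S env a (\<lambda>u s. wps F S env as (\<lambda>us t. Q (u # us) (s + t)))" by simp
  from Cons.prems(1)[OF _ this] obtain u s t where
    u: "wps F S env as (\<lambda>us t. Q (u # us) (s + t))" "vsize u \<le> S" "t \<le> s * S" "eval F env a u t"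
    by auto
  have "\<exists>vs n t. Q (u # vs) (s + n) \<and> (\<forall>v\<in>set vs. vsize v \<le> S) \<and> t \<le> n * S
      \<and> evals F env as vs t"
    using Cons.IH[OF Cons.prems(1) u(1)] by simp
  then obtain vs n t' where
    vs: "Q (u # vs) (s + n)" "\<forall>v\<in>set vs. vsize v \<le> S" "t' \<le> n * S" "evals F env as vs t'"
    by blast
  have "evals F env (a # as) (u # vs) (t + t')" by (rule eval_evals.Cons[OF u(4) vs(4)])
  moreover have "t + t' \<le> (s + n) * S" using u(3) vs(3) by (simp add: distrib_right)
  ultimately show ?case using u(2) vs 
    by (intro exI[of _ "u # vs"] exI[of _ "s + n"] exI[of _ "t + t'"]) auto
qed

text \<open>Each evaluation rule for an expression adds the size of the produced value, at most
  \<open>S\<close>, to the costs of its premises, while the step counter rises by one. Termination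
  is included, since a specification of a callee provides an evaluation.\<close>

lemma wp_sound:
  assumes "2 \<le> S" "\<forall>u\<in>set env. vsize u \<le> S" "wp F S env e Q"
  shows "\<exists>v n t. Q v n \<and> vsize v \<le> S \<and> t \<le> n * S \<and> eval F env e v t"
  using assms(2,3)
proof (induction e arbitrary: env Q)
  case (Var i)
  then show ?case
    by (intro exI[of _ "env ! i"] exI[of _ 1] exI[of _ "vsize (env ! i)"]) (auto intro: eval_evals.Var)
next
  case (Const c)
  then show ?case
    by (intro exI[of _ "Atom c"] exI[of _ 1] exI[of _ "vsize (Atom c)"])
       (auto intro: eval_evals.Const simp del: vsize.simps)
next
  case (Arith f a b)
  from Arith.prems(2) have "wp F S env a (\<lambda>u s. wp F S env b (\<lambda>w t.
     \<exists>m n. u = Atom m \<and> w = Atom n \<and>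
       (f = Add \<or> f = Mul \<longrightarrow> vsize (Atom (arith_sem f m n)) \<le> S) \<and>
       Q (Atom (arith_sem f m n)) (Suc (s + t))))" by simp
  from Arith.IH(1)[OF Arith.prems(1) this] obtain u s t where u: "vsize u \<le> S" "t \<le> s * S"
    "eval F env a u t" "wp F S env b (\<lambda>w t. \<exists>m n. u = Atom m \<and> w = Atom n \<and>
       (f = Add \<or> f = Mul \<longrightarrow> vsize (Atom (arith_sem f m n)) \<le> S) \<and>
       Q (Atom (arith_sem f m n)) (Suc (s + t)))" by blast
  from Arith.IH(2)[OF Arith.prems(1) u(4)] obtain m n s' t' where w: "vsize (Atom n) \<le> S"
    "t' \<le> s' * S" "u = Atom m" "eval F env b (Atom n) t'"
    "f = Add \<or> f = Mul \<longrightarrow> vsize (Atom (arith_sem f m n)) \<le> S"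
    "Q (Atom (arith_sem f m n)) (Suc (s + s'))" by blast
  let ?r = "Atom (arith_sem f m n)"
  have r: "vsize ?r \<le> S" using vsize_arith assms(1) u(1) w by blast
  have "eval F env (Arith f a b) ?r (t + t' + vsize ?r)"
    using eval_evals.Arith[OF _ w(4) refl] u(3) w(3) by blast
  moreover have "t + t' + vsize ?r \<le> Suc (s + s') * S"
    using u(2) w(2) r by (simp add: distrib_right)
  ultimately show ?case using w(6) r by blast
next
  case (MkCell a b)
  from MkCell.prems(2) have "wp F S env a (\<lambda>u s. wp F S env b (\<lambda>w t.
     vsize (Cell u w) \<le> S \<and> Q (Cell u w) (Suc (s + t))))" by simp
  from MkCell.IH(1)[OF MkCell.prems(1) this] obtain u s t where u: "t \<le> s * S"
    "eval F env a u t" "wp F S env b (\<lambda>w t. vsize (Cell u w) \<le> S \<and> Q (Cell u w) (Suc (s + t)))"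
    by blast
  from MkCell.IH(2)[OF MkCell.prems(1) u(3)] obtain w s' t' where w: "t' \<le> s' * S"
    "eval F env b w t'" "vsize (Cell u w) \<le> S" "Q (Cell u w) (Suc (s + s'))" by blast
  have "eval F env (MkCell a b) (Cell u w) (t + t' + vsize (Cell u w))"
    by (rule eval_evals.MkCell[OF u(2) w(2)])
  moreover have "t + t' + vsize (Cell u w) \<le> Suc (s + s') * S"
    using u(1) w(1,3) by (simp add: distrib_right)
  ultimately show ?case using w(3,4) by blast
next
  case (Fst a)
  from Fst.prems(2) have "wp F S env a (\<lambda>u s. \<exists>x y. u = Cell x y \<and> Q x (Suc s))" by simp
  from Fst.IH[OF Fst.prems(1) this] obtain x y s t where u: "vsize (Cell x y) \<le> S" "t \<le> s * S"
    "eval F env a (Cell x y) t" "Q x (Suc s)" by blast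
  have "eval F env (Fst a) x (t + vsize x)" by (rule eval_evals.Fst[OF u(3)])
  moreover have "vsize x \<le> S" "t + vsize x \<le> Suc s * S" using u by auto
  ultimately show ?case using u(4) by blast
next
  case (Snd a)
  from Snd.prems(2) have "wp F S env a (\<lambda>u s. \<exists>x y. u = Cell x y \<and> Q y (Suc s))" by simp
  from Snd.IH[OF Snd.prems(1) this] obtain x y s t where u: "vsize (Cell x y) \<le> S" "t \<le> s * S"
    "eval F env a (Cell x y) t" "Q y (Suc s)" by blast
  have "eval F env (Snd a) y (t + vsize y)" by (rule eval_evals.Snd[OF u(3)])
  moreover have "vsize y \<le> S" "t + vsize y \<le> Suc s * S" using u by auto
  ultimately show ?case using u(4) by blast
next
  case (Cond c a b)
  from Cond.prems(2) have "wp F S env c (\<lambda>u r.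
     (u \<noteq> Atom 0 \<longrightarrow> wp F S env a (\<lambda>v s. Q v (Suc (r + s)))) \<and>
     (u = Atom 0 \<longrightarrow> wp F S env b (\<lambda>v s. Q v (Suc (r + s)))))" by simp
  from Cond.IH(1)[OF Cond.prems(1) this] obtain u s t where u: "t \<le> s * S" "eval F env c u t"
     "u \<noteq> Atom 0 \<longrightarrow> wp F S env a (\<lambda>v s'. Q v (Suc (s + s')))"
     "u = Atom 0 \<longrightarrow> wp F S env b (\<lambda>v s'. Q v (Suc (s + s')))" by blast
  have "\<exists>v s' t'. Q v (Suc (s + s')) \<and> vsize v \<le> S \<and> t' \<le> s' * S
      \<and> eval F env (Cond c a b) v (t + t' + vsize v)"
  proof (cases "u = Atom 0")
    case True
    then show ?thesis
      using Cond.IH(3)[OF Cond.prems(1) u(4)[rule_format, OF True]] u(2)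
      by (blast intro: eval_evals.Cond_False)
  next
    case False
    then show ?thesis
      using Cond.IH(2)[OF Cond.prems(1) u(3)[rule_format, OF False]] u(2)
      by (blast intro: eval_evals.Cond_True)
  qed
  then obtain v s' t' where v: "Q v (Suc (s + s'))" "vsize v \<le> S" "t' \<le> s' * S"
      "eval F env (Cond c a b) v (t + t' + vsize v)" by blast
  moreover have "t + t' + vsize v \<le> Suc (s + s') * S" using u(1) v by (simp add: distrib_right)
  ultimately show ?case by blast
next
  case (LetIn a b)
  from LetIn.prems(2) have "wp F S env a (\<lambda>u s.
     wp F S (u # env) b (\<lambda>v t. Q v (Suc (s + t))))" by simp
  from LetIn.IH(1)[OF LetIn.prems(1) this] obtain u s t where u: "vsize u \<le> S" "t \<le> s * S"
    "eval F env a u t" "wp F S (u # env) b (\<lambda>v t. Q v (Suc (s + t)))" by blast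
  have "\<forall>u\<in>set (u # env). vsize u \<le> S" using u(1) LetIn.prems(1) by simp
  from LetIn.IH(2)[OF this u(4)] obtain v s' t' where v: "vsize v \<le> S" "t' \<le> s' * S"
    "eval F (u # env) b v t'" "Q v (Suc (s + s'))" by blast
  have "eval F env (LetIn a b) v (t + t' + vsize v)" by (rule eval_evals.LetIn[OF u(3) v(3)])
  moreover have "t + t' + vsize v \<le> Suc (s + s') * S" using u v by (simp add: distrib_right)
  ultimately show ?case using v by blast
next
  case (Call f as)
  from Call.prems(2) have "wps F S env as (\<lambda>us s. \<exists>v n. calls F S f us v n \<and> Q v (Suc (s + n)))"
    by (simp add: with_call_def)
  from wps_sound[OF Call.IH[OF _ Call.prems(1)] this] obtain us s t v n where
    u: "\<forall>v\<in>set us. vsize v \<le> S" "t \<le> s * S" "evals F env as us t" "calls F S f us v n"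
      "Q v (Suc (s + n))" by blast
  then obtain t' where v: "f < length F" "vsize v \<le> S" "t' \<le> n * S" "eval F us (F ! f) v t'"
    unfolding calls_def by blast
  have "eval F env (Call f as) v (t + t' + vsize v)" by (rule eval_evals.Call[OF u(3) v(1,4)])
  moreover have "t + t' + vsize v \<le> Suc (s + n) * S" using u v by (simp add: distrib_right)
  ultimately show ?case using v u by blast
qed

lemma callsI:
  assumes "2 \<le> S" "f < length F"
    and "(\<forall>u\<in>set us. vsize u \<le> S) \<Longrightarrow> wp F S us (F ! f) (\<lambda>v' n'. v' = v \<and> n' \<le> n)"
  shows "calls F S f us v n"
  unfolding calls_def
proof (intro conjI impI)
  assume us: "\<forall>u\<in>set us. vsize u \<le> S"
  obtain n' t where "n' \<le> n" "vsize v \<le> S" "t \<le> n' * S" "eval F us (F ! f) v t"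
    using wp_sound[OF assms(1) us assms(3)[OF us]] by blast
  moreover from this have "t \<le> n * S" by (meson mult_le_mono1 order_trans)
  ultimately show "vsize v \<le> S" "\<exists>t\<le>n * S. eval F us (F ! f) v t" by blast+
qed (rule assms(2))

lemma with_callI: "calls F S f us v n \<Longrightarrow> Q v n \<Longrightarrow> with_call F S f us Q"
  unfolding with_call_def by blast

section \<open>The program and its running time\<close>

declare vsize.simps(1) [simp del]

text \<open>The number in a \<open>Call\<close> is the position of the callee in
  \<open>prog\<close>: 0 length, 1 count, 2 load, 3 annotate, 4 next, 5 lift, 6 phases, 7 edges, 8
  copies, 9 vertices, 10 shares, 11 factorial.\<close>

definition len_body :: exp where
  "len_body = Cond (Var 0) (Arith Add (Const 1) (Call 0 [Snd (Var 0)])) (Const 0)"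

text \<open>Equality of two numbers is tested by multiplying the two comparisons, which yields the
  summand 0 or 1 directly.\<close>

definition count_body :: exp where
  "count_body = Cond (Var 1)
     (Arith Add
       (Arith Mul (Arith Leq (Var 0) (Fst (Fst (Var 1)))) (Arith Leq (Fst (Fst (Var 1))) (Var 0)))
       (Call 1 [Var 0, Snd (Var 1)]))
     (Const 0)"

definition load_body :: exp where
  "load_body = Cond (Var 1)
     (Arith Add
       (Arith Mul (Call 1 [Var 0, Fst (Fst (Var 1))]) (Snd (Fst (Var 1))))
       (Call 2 [Var 0, Snd (Var 1)]))
     (Const 0)"

text \<open>The arguments are the table of one edge, the list of all edges with their shares, and
  the period. Each vertex is given its width, with its load recomputed from the whole list.\<close>

definition annotate_body :: exp where
  "annotate_body = Cond (Var 0)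
     (MkCell (MkCell (Fst (Var 0)) (Arith Div (Var 2) (Call 2 [Fst (Fst (Var 0)), Var 1])))
       (Call 3 [Snd (Var 0), Var 1, Var 2]))
     (Const 0)"

text \<open>With truncated subtraction, \<open>a - (a - b)\<close> is the minimum of \<open>a\<close> and \<open>b\<close>.\<close>

definition next_body :: exp where
  "next_body = Cond (Var 0)
     (Call 4 [Snd (Var 0), Var 1,
       Arith Sub (Var 2) (Arith Sub (Var 2)
         (Arith Mul (Arith Add (Arith Div (Var 1) (Snd (Fst (Var 0)))) (Const 1))
           (Snd (Fst (Var 0)))))])
     (Var 2)"

definition lift_body :: exp where
  "lift_body = Cond (Var 0)
     (MkCell
       (MkCell
         (Arith Add (Arith Mul (Fst (Fst (Fst (Var 0)))) (Var 2))
           (Arith Div (Var 1) (Snd (Fst (Var 0)))))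
         (Snd (Fst (Fst (Var 0)))))
       (Call 5 [Snd (Var 0), Var 1, Var 2]))
     (Const 0)"

text \<open>The loop jumps from a phase \<open>r\<close> to the first later phase in which some vertex of the edge
  changes its copy; these jumps number at most the copies of the vertices of the edge, although
  there are factorially many phases.\<close>

definition phases_body :: exp where
  "phases_body = Cond (Arith Leq (Var 2) (Var 1)) (Var 5)
     (LetIn (Call 4 [Var 0, Var 1, Var 2])
       (MkCell
         (MkCell (Call 5 [Var 1, Var 2, Var 5])
           (MkCell (Arith Mul (Var 4) (Arith Sub (Var 0) (Var 2))) (Arith Mul (Var 5) (Var 3))))
         (Call 6 [Var 1, Var 0, Var 3, Var 4, Var 5, Var 6])))"

text \<open>The first argument is consumed, while the second keeps all edges for the computation of
  loads. The output for the later edges is passed as accumulator to the phase loop, which avoids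
  appending lists. An edge of share 0 fails the inner test and is skipped.\<close>

definition edges_body :: exp where
  "edges_body = Cond (Var 0)
     (Cond (Snd (Fst (Var 0)))
       (Call 6 [Call 3 [Fst (Fst (Var 0)), Var 1, Var 2], Const 0, Var 2, Snd (Fst (Var 0)), Var 3,
         Call 7 [Snd (Var 0), Var 1, Var 2, Var 3]])
       (Call 7 [Snd (Var 0), Var 1, Var 2, Var 3]))
     (Const 0)"

text \<open>Counting down makes the copies appear in descending order, hence the reversed ranges in
  the specifications.\<close>

definition copies_body :: exp where
  "copies_body = Cond (Var 1)
     (MkCell (Arith Add (Arith Mul (Var 0) (Var 2)) (Arith Sub (Var 1) (Const 1)))
       (Call 8 [Var 0, Arith Sub (Var 1) (Const 1), Var 2, Var 3]))
     (Var 3)"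

definition verts_body :: exp where
  "verts_body = Cond (Var 0)
     (Call 8 [Fst (Var 0), Call 2 [Fst (Var 0), Var 1], Var 2, Call 9 [Snd (Var 0), Var 1, Var 2]])
     (Const 0)"

definition shares_body :: exp where
  "shares_body = Cond (Var 0)
     (LetIn (Cond (Snd (Var 0))
         (Arith Div (Arith Mul (Fst (Snd (Fst (Var 0)))) (Var 2)) (Snd (Snd (Fst (Var 0)))))
         (Var 1))
       (MkCell (MkCell (Fst (Fst (Var 1))) (Var 0))
         (Call 10 [Snd (Var 1), Arith Sub (Var 2) (Var 0), Var 3])))
     (Const 0)"

definition fact_body :: exp where
  "fact_body = Cond (Var 0) (Arith Mul (Var 0) (Call 11 [Arith Sub (Var 0) (Const 1)])) (Const 1)"

definition prog :: "exp list" where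
  "prog = [len_body, count_body, load_body, annotate_body, next_body, lift_body, phases_body,
     edges_body, copies_body, verts_body, shares_body, fact_body]"

text \<open>Inside the three bindings, the variables 0 to 3 are the period, the edges with their
  shares, \<open>grid\<close>, and the input.\<close>

definition main_body :: exp where
  "main_body =
     LetIn (Arith Mul (Call 0 [Fst (Var 0)]) (Call 0 [Snd (Snd (Var 0))]))
    (LetIn (Call 10 [Snd (Snd (Var 1)), Var 0, Var 0])
    (LetIn (Call 11 [Var 1])
      (MkCell (Call 9 [Fst (Var 3), Var 1, Var 2])
        (MkCell (Fst (Snd (Var 3))) (Call 7 [Var 1, Var 1, Var 0, Var 2])))))"

lemma prog_length: "length prog = 12"
  by (simp add: prog_def)

lemma prog_nth:
  "prog ! 0 = len_body" "prog ! Suc 0 = count_body" "prog ! 2 = load_body" "prog ! 3 = annotate_body"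
  "prog ! 4 = next_body" "prog ! 5 = lift_body" "prog ! 6 = phases_body" "prog ! 7 = edges_body"
  "prog ! 8 = copies_body" "prog ! 9 = verts_body" "prog ! 10 = shares_body"
  "prog ! 11 = fact_body"
  by (simp_all add: prog_def)

section \<open>Functional models of the data and of the loops\<close>

definition table_val :: "(nat \<Rightarrow> val) \<Rightarrow> nat list \<Rightarrow> val" where
  "table_val g e = list_val (map (\<lambda>v. Cell (Atom v) (g v)) e)"

text \<open>The bijection tables enter as arbitrary values \<open>g e v\<close>: the program copies
  them along and never inspects them.\<close>

definition shared_val :: "(nat list \<Rightarrow> nat \<Rightarrow> val) \<Rightarrow> (nat list \<Rightarrow> nat) \<Rightarrow> nat list list \<Rightarrow> val" where
  "shared_val g m es = list_val (map (\<lambda>e. Cell (table_val (g e) e) (Atom (m e))) es)"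

definition width_val :: "(nat \<Rightarrow> nat) \<Rightarrow> (nat \<Rightarrow> val) \<Rightarrow> nat list \<Rightarrow> val" where
  "width_val W g e = list_val (map (\<lambda>v. Cell (Cell (Atom v) (g v)) (Atom (W v))) e)"

lemma table_val_simps [simp]:
  "table_val g [] = Atom 0"
  "table_val g (v # e) = Cell (Cell (Atom v) (g v)) (table_val g e)"
  by (simp_all add: table_val_def)

lemma shared_val_simps [simp]:
  "shared_val g m [] = Atom 0"
  "shared_val g m (e # es) = Cell (Cell (table_val (g e) e) (Atom (m e))) (shared_val g m es)"
  by (simp_all add: shared_val_def)

lemma width_val_simps [simp]:
  "width_val W g [] = Atom 0"
  "width_val W g (v # e) = Cell (Cell (Cell (Atom v) (g v)) (Atom (W v))) (width_val W g e)"
  by (simp_all add: width_val_def)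

text \<open>Like the program, this counts occurrences instead of testing membership; as edges have
  distinct entries, it will agree with \<open>num_copies\<close>.\<close>

definition load :: "(nat list \<Rightarrow> nat) \<Rightarrow> nat list list \<Rightarrow> nat \<Rightarrow> nat" where
  "load m es v = (\<Sum>e\<leftarrow>es. count_list e v * m e)"

text \<open>\<open>Suc (r div W v) * W v\<close> is where the block of \<open>v\<close> around
  \<open>r\<close> ends. For positive widths the minimum is thus the first later phase in which some
  copy changes, capped at \<open>R\<close>.\<close>

definition next_phase :: "(nat \<Rightarrow> nat) \<Rightarrow> nat list \<Rightarrow> nat \<Rightarrow> nat \<Rightarrow> nat" where
  "next_phase W e r R = fold (\<lambda>v b. min b (Suc (r div W v) * W v)) e R"

lemma load_simps [simp]:
  "load m [] v = 0"
  "load m (e # es) v = count_list e v * m e + load m es v"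
  by (simp_all add: load_def)

lemma next_phase_simps [simp]:
  "next_phase W [] r R = R"
  "next_phase W (v # e) r R = next_phase W e r (min R (Suc (r div W v) * W v))"
  by (simp_all add: next_phase_def)

text \<open>The guard \<open>r < f r\<close> makes the recursion terminate for every
  \<open>f\<close>. The entries are the left ends of the intervals visited by the loop.\<close>

function orbit :: "(nat \<Rightarrow> nat) \<Rightarrow> nat \<Rightarrow> nat \<Rightarrow> nat list" where
  "orbit f R r = (if r < R \<and> r < f r then r # orbit f R (f r) else [])"
  by auto
termination by (relation "Wellfounded.measure (\<lambda>(f, R, r). R - r)") auto

declare orbit.simps [simp del]

definition phase_val ::
  "(nat \<Rightarrow> nat) \<Rightarrow> (nat \<Rightarrow> val) \<Rightarrow> nat list \<Rightarrow> nat \<Rightarrow> nat \<Rightarrow> nat \<Rightarrow> nat \<Rightarrow> val" where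
  "phase_val W g e R m N r =
     Cell (list_val (map (\<lambda>v. Cell (Atom (v * N + r div W v)) (g v)) e))
       (Cell (Atom (m * (next_phase W e r R - r))) (Atom (N * R)))"

definition edges_vals ::
  "(nat \<Rightarrow> nat) \<Rightarrow> (nat list \<Rightarrow> nat \<Rightarrow> val) \<Rightarrow> (nat list \<Rightarrow> nat) \<Rightarrow> nat \<Rightarrow> nat \<Rightarrow> nat list list \<Rightarrow> val list"
where
  "edges_vals W g m R N es = concat (map (\<lambda>e. if m e = 0 then [] else
     map (phase_val W (g e) e R (m e) N) (orbit (\<lambda>r. next_phase W e r R) R 0)) es)"

lemma edges_vals_simps [simp]:
  "edges_vals W g m R N [] = []"
  "edges_vals W g m R N (e # es) = (if m e = 0 then [] else
     map (phase_val W (g e) e R (m e) N) (orbit (\<lambda>r. next_phase W e r R) R 0))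
     @ edges_vals W g m R N es"
  by (simp_all add: edges_vals_def)

lemma vsize_append: "vsize (list_val ys) \<le> vsize (list_val (xs @ ys))"
  by (induction xs) auto

definition weighted_val ::
  "(nat list \<Rightarrow> nat \<Rightarrow> val) \<Rightarrow> (nat list \<Rightarrow> nat) \<Rightarrow> (nat list \<Rightarrow> nat) \<Rightarrow> nat list list \<Rightarrow> val"
where
  "weighted_val g num den es = list_val
     (map (\<lambda>e. Cell (table_val (g e) e) (Cell (Atom (num e)) (Atom (den e)))) es)"

lemma weighted_val_simps [simp]:
  "weighted_val g num den [] = Atom 0"
  "weighted_val g num den (e # es) =
    Cell (Cell (table_val (g e) e) (Cell (Atom (num e)) (Atom (den e)))) (weighted_val g num den es)"
  by (simp_all add: weighted_val_def)

text \<open>\<open>B\<close> is meant to bound the numbers of a run and \<open>S\<close> the sizes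
  of its values. The lower bound 2 is the size of the truth value 1.\<close>

locale budget =
  fixes S B :: nat
  assumes two_le: "2 \<le> S" and bound_size: "vsize (Atom B) \<le> S"
begin

section \<open>Step counts of the functions of the program\<close>

lemma atom_size: "n \<le> B \<Longrightarrow> vsize (Atom n) \<le> S"
  using bound_size floorlog_mono[of n B 2] by (simp add: vsize.simps(1))

lemma const_size [simp]: "vsize (Atom 0) \<le> S" "vsize (Atom (Suc 0)) \<le> S"
  using two_le floorlog_leI[of 0 2 0] floorlog_leI[of 1 2 1] by (simp_all add: vsize.simps(1))

lemmas run = callsI[OF two_le, of _ prog, unfolded prog_length]

text \<open>The pattern of the recursive specifications that follow: induction over the data, with
  the induction hypothesis serving as specification of the recursive call. Coefficients are rounded
  up.\<close>

lemma calls_len: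
  "length xs \<le> B \<Longrightarrow> calls prog S 0 [list_val xs] (Atom (length xs)) (10 * length xs + 5)"
proof (induction xs)
  case Nil
  show ?case by (rule run) (simp_all add: prog_nth len_body_def)
next
  case (Cons x xs)
  then have IH: "calls prog S 0 [list_val xs] (Atom (length xs)) (10 * length xs + 5)" by simp
  show ?case
    using Cons.prems
    by (intro run) (simp_all add: prog_nth len_body_def with_callI[OF IH] atom_size)
qed

lemma calls_count:
  "length e \<le> B \<Longrightarrow>
    calls prog S (Suc 0) [Atom v, table_val g e] (Atom (count_list e v)) (30 * length e + 5)"
proof (induction e)
  case Nil
  show ?case by (rule run) (simp_all add: prog_nth count_body_def)
next
  case (Cons u e)
  then have IH: "calls prog S (Suc 0) [Atom v, table_val g e] (Atom (count_list e v))
      (30 * length e + 5)"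
    by simp
  have le: "count_list e v \<le> length e" by (rule count_le_length)
  show ?case
    using Cons.prems le
    by (intro run) (auto simp: prog_nth count_body_def atom_size intro!: with_callI[OF IH])
qed

lemma calls_load:
  "\<lbrakk>\<forall>e\<in>set es. length e \<le> L; L \<le> B; load m es v \<le> B\<rbrakk> \<Longrightarrow>
    calls prog S 2 [Atom v, shared_val g m es] (Atom (load m es v)) ((30 * L + 40) * length es + 5)"
proof (induction es)
  case Nil
  show ?case by (rule run) (simp_all add: prog_nth load_body_def)
next
  case (Cons e es)
  then have IH: "calls prog S 2 [Atom v, shared_val g m es] (Atom (load m es v))
      ((30 * L + 40) * length es + 5)"
    by simp
  have count: "calls prog S (Suc 0) [Atom v, table_val (g e) e] (Atom (count_list e v))
      (30 * length e + 5)"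
    by (rule calls_count) (use Cons.prems in auto)
  show ?case
    using Cons.prems
    by (intro run)
      (auto simp: prog_nth load_body_def atom_size intro!: with_callI[OF IH] with_callI[OF count])
qed

lemma calls_annotate:
  assumes "\<forall>e\<in>set es. length e \<le> L" "L \<le> B"
  shows "\<lbrakk>\<forall>v\<in>set e. load m es v \<le> B; vsize (width_val (\<lambda>v. R div load m es v) g e) \<le> S\<rbrakk> \<Longrightarrow>
    calls prog S 3 [table_val g e, shared_val h m es, Atom R]
      (width_val (\<lambda>v. R div load m es v) g e)
      (((30 * L + 40) * length es + 30) * length e + 5)"
proof (induction e)
  case Nil
  show ?case by (rule run) (simp_all add: prog_nth annotate_body_def)
next
  case (Cons v e)
  then have IH: "calls prog S 3 [table_val g e, shared_val h m es, Atom R]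
      (width_val (\<lambda>v. R div load m es v) g e)
      (((30 * L + 40) * length es + 30) * length e + 5)"
    by simp
  have deg: "calls prog S 2 [Atom v, shared_val h m es] (Atom (load m es v))
      ((30 * L + 40) * length es + 5)"
    by (rule calls_load) (use assms Cons.prems in auto)
  show ?case
    using Cons.prems
    by (intro run)
      (auto simp: prog_nth annotate_body_def atom_size intro!: with_callI[OF IH] with_callI[OF deg])
qed

lemma calls_next:
  "\<lbrakk>\<forall>v\<in>set e. Suc (r div W v) * W v \<le> B; Suc r \<le> B\<rbrakk> \<Longrightarrow>
    calls prog S 4 [width_val W g e, Atom r, Atom R] (Atom (next_phase W e r R)) (30 * length e + 5)"
proof (induction e arbitrary: R)
  case Nil
  show ?case by (rule run) (simp_all add: prog_nth next_body_def)
next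
  case (Cons v e)
  let ?c = "Suc (r div W v) * W v"
  have IH: "calls prog S 4 [width_val W g e, Atom r, Atom (R - (R - ?c))]
      (Atom (next_phase W e r (R - (R - ?c)))) (30 * length e + 5)"
    by (rule Cons.IH) (use Cons.prems in simp_all)
  have min: "min R (W v + r div W v * W v) = R - (R - (W v + r div W v * W v))" by simp
  \<comment> \<open>This intermediate sum also needs a size check, which the assumption
    \<open>Suc r \<le> B\<close> supplies.\<close>
  have "Suc (r div W v) \<le> B" using Cons.prems(2) div_le_dividend[of r "W v"] by linarith
  then show ?case
    using Cons.prems
    by (intro run) (auto simp: prog_nth next_body_def atom_size min intro!: with_callI[OF IH[simplified]])
qed

lemma calls_lift:
  "\<lbrakk>\<forall>v\<in>set e. v * N + r div W v \<le> B;
    vsize (list_val (map (\<lambda>v. Cell (Atom (v * N + r div W v)) (g v)) e)) \<le> S\<rbrakk> \<Longrightarrow>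
    calls prog S 5 [width_val W g e, Atom r, Atom N]
      (list_val (map (\<lambda>v. Cell (Atom (v * N + r div W v)) (g v)) e)) (30 * length e + 5)"
proof (induction e)
  case Nil
  show ?case by (rule run) (simp_all add: prog_nth lift_body_def)
next
  case (Cons v e)
  then have IH: "calls prog S 5 [width_val W g e, Atom r, Atom N]
      (list_val (map (\<lambda>v. Cell (Atom (v * N + r div W v)) (g v)) e)) (30 * length e + 5)"
    by simp
  show ?case
    using Cons.prems
    by (intro run) (auto simp: prog_nth lift_body_def atom_size intro!: with_callI[OF IH])
qed

text \<open>The induction is on the number of remaining phases, which may be huge; the step bound
  counts only the iterations, that is, the entries of the orbit.\<close>

lemma calls_phases:
  assumes next_gt: "\<And>r. r < R \<Longrightarrow> r < next_phase W e r R"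
    and "\<And>r v. \<lbrakk>r < R; v \<in> set e\<rbrakk> \<Longrightarrow> Suc (r div W v) * W v \<le> B"
    and "\<And>r v. \<lbrakk>r < R; v \<in> set e\<rbrakk> \<Longrightarrow> v * N + r div W v \<le> B"
    and "\<And>r. r < R \<Longrightarrow> m * (next_phase W e r R - r) \<le> B"
    and "N * R \<le> B" "R \<le> B"
  shows "vsize (list_val (map (phase_val W g e R m N) (orbit (\<lambda>r. next_phase W e r R) R r) @ ys)) \<le> S \<Longrightarrow>
    calls prog S 6 [width_val W g e, Atom r, Atom R, Atom m, Atom N, list_val ys]
      (list_val (map (phase_val W g e R m N) (orbit (\<lambda>r. next_phase W e r R) R r) @ ys))
      ((60 * length e + 60) * length (orbit (\<lambda>r. next_phase W e r R) R r) + 5)"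
proof (induction "R - r" arbitrary: r rule: less_induct)
  case less
  let ?f = "\<lambda>r. next_phase W e r R"
  show ?case
  proof (cases "r < R")
    case False
    then show ?thesis by (intro run) (simp_all add: prog_nth phases_body_def orbit.simps)
  next
    case True
    have orb: "orbit ?f R r = r # orbit ?f R (?f r)"
      using True next_gt[OF True] by (subst orbit.simps) simp
    have size: "vsize (phase_val W g e R m N r) \<le> S"
        "vsize (list_val (map (phase_val W g e R m N) (orbit ?f R (?f r)) @ ys)) \<le> S"
      using less.prems by (simp_all add: orb)
    have IH: "calls prog S 6 [width_val W g e, Atom (?f r), Atom R, Atom m, Atom N, list_val ys]
        (list_val (map (phase_val W g e R m N) (orbit ?f R (?f r)) @ ys))
        ((60 * length e + 60) * length (orbit ?f R (?f r)) + 5)"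
      by (rule less.hyps) (use True next_gt[OF True] size in auto)
    have nxt: "calls prog S 4 [width_val W g e, Atom r, Atom R] (Atom (?f r)) (30 * length e + 5)"
      by (rule calls_next) (use assms True in auto)
    have lft: "calls prog S 5 [width_val W g e, Atom r, Atom N]
        (list_val (map (\<lambda>v. Cell (Atom (v * N + r div W v)) (g v)) e)) (30 * length e + 5)"
      by (rule calls_lift) (use assms True size in \<open>auto simp: phase_val_def\<close>)
    show ?thesis
      using less.prems True assms(4)[OF True] assms(5) size
      by (intro run)
        (auto simp: prog_nth phases_body_def orb phase_val_def atom_size
          intro!: with_callI[OF IH] with_callI[OF nxt] with_callI[OF lft])
  qed
qed

text \<open>The list \<open>es\<close> shrinks during the recursion while \<open>es0\<close> stays
  fixed, since widths depend on all edges. \<open>K\<close> bounds the number of intervals per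
  edge.\<close>

lemma calls_edges:
  fixes es0 :: "nat list list" and m :: "nat list \<Rightarrow> nat" and R :: nat
  defines "W \<equiv> \<lambda>v. R div load m es0 v"
  assumes "\<forall>e\<in>set es0. length e \<le> L" "L \<le> B" "\<forall>v. load m es0 v \<le> B"
    and phase: "\<And>e r. \<lbrakk>e \<in> set es0; 0 < m e; r < R\<rbrakk> \<Longrightarrow>
        r < next_phase W e r R \<and> m e * (next_phase W e r R - r) \<le> B"
    and slot: "\<And>e r v. \<lbrakk>e \<in> set es0; 0 < m e; r < R; v \<in> set e\<rbrakk> \<Longrightarrow>
        Suc (r div W v) * W v \<le> B \<and> v * N + r div W v \<le> B"
    and "N * R \<le> B" "R \<le> B"
    and widths: "\<And>e. e \<in> set es0 \<Longrightarrow> vsize (width_val W (g e) e) \<le> S"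
    and orbits: "\<And>e. e \<in> set es0 \<Longrightarrow> 0 < m e \<Longrightarrow> length (orbit (\<lambda>r. next_phase W e r R) R 0) \<le> K"
  shows "\<lbrakk>set es \<subseteq> set es0; vsize (list_val (edges_vals W g m R N es)) \<le> S\<rbrakk> \<Longrightarrow>
    calls prog S 7 [shared_val g m es, shared_val g m es0, Atom R, Atom N]
      (list_val (edges_vals W g m R N es))
      (((60 * L + 60) * K + ((30 * L + 40) * length es0 + 30) * L + 50) * length es + 5)"
proof (induction es)
  case Nil
  show ?case by (rule run) (simp_all add: prog_nth edges_body_def)
next
  case (Cons e es)
  let ?orb = "orbit (\<lambda>r. next_phase W e r R) R 0"
  let ?ann = "((30 * L + 40) * length es0 + 30) * length e + 5"
  have e: "e \<in> set es0" and len: "length e \<le> L" using Cons.prems assms(2) by auto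
  have IH: "calls prog S 7 [shared_val g m es, shared_val g m es0, Atom R, Atom N]
      (list_val (edges_vals W g m R N es))
      (((60 * L + 60) * K + ((30 * L + 40) * length es0 + 30) * L + 50) * length es + 5)"
    by (rule Cons.IH) (use Cons.prems vsize_append in \<open>auto intro: order_trans\<close>)
  show ?case
  proof (cases "m e = 0")
    case True
    then show ?thesis
      by (intro run) (simp_all add: prog_nth edges_body_def with_callI[OF IH])
  next
    case False
    have ann: "calls prog S 3 [table_val (g e) e, shared_val g m es0, Atom R] (width_val W (g e) e)
        ?ann"
      unfolding W_def by (rule calls_annotate)
        (use assms(2-4) widths[OF e] in \<open>auto simp: W_def\<close>)
    have phs: "calls prog S 6 [width_val W (g e) e, Atom 0, Atom R, Atom (m e), Atom N,
        list_val (edges_vals W g m R N es)]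
        (list_val (map (phase_val W (g e) e R (m e) N) ?orb @ edges_vals W g m R N es))
        ((60 * length e + 60) * length ?orb + 5)"
      by (rule calls_phases) (use phase[OF e] slot[OF e] False assms(7,8) Cons.prems in auto)
    \<comment> \<open>Naming the nonlinear bounds leaves a comparison that is linear in the
      names.\<close>
    define a a0 b b0 where "a = ((30 * L + 40) * length es0 + 30) * length e"
      and "a0 = ((30 * L + 40) * length es0 + 30) * L"
      and "b = (60 * length e + 60) * length ?orb" and "b0 = (60 * L + 60) * K"
    note folds = a_def[symmetric] a0_def[symmetric] b_def[symmetric] b0_def[symmetric]
    have "b \<le> b0"
      unfolding b_def b0_def using len orbits[OF e] False by (intro mult_le_mono) auto
    moreover have "a \<le> a0"
      unfolding a_def a0_def using len by (intro mult_le_mono) auto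
    ultimately show ?thesis
      using False unfolding folds
      by (intro run) (auto simp: prog_nth edges_body_def intro!: with_callI[OF IH[unfolded folds]]
          with_callI[OF ann[unfolded folds]] with_callI[OF phs[unfolded folds]])
  qed
qed

lemma calls_copies:
  "\<lbrakk>v * N + c \<le> B; vsize (list_val (map (\<lambda>i. Atom (v * N + i)) (rev [0..<c]) @ ys)) \<le> S\<rbrakk> \<Longrightarrow>
    calls prog S 8 [Atom v, Atom c, Atom N, list_val ys]
      (list_val (map (\<lambda>i. Atom (v * N + i)) (rev [0..<c]) @ ys)) (30 * c + 5)"
proof (induction c)
  case 0
  show ?case by (rule run) (simp_all add: prog_nth copies_body_def)
next
  case (Suc c)
  then have IH: "calls prog S 8 [Atom v, Atom c, Atom N, list_val ys]
      (list_val (map (\<lambda>i. Atom (v * N + i)) (rev [0..<c]) @ ys)) (30 * c + 5)"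
    by simp
  show ?case
    using Suc.prems
    by (intro run) (auto simp: prog_nth copies_body_def atom_size intro!: with_callI[OF IH])
qed

lemma calls_verts:
  assumes "\<forall>e\<in>set es. length e \<le> L" "L \<le> B" "\<forall>v. load m es v \<le> D" "D \<le> B"
  shows "\<lbrakk>\<forall>v\<in>set vs. v * N + load m es v \<le> B;
    vsize (list_val (map Atom (concat (map (\<lambda>v. map (\<lambda>i. v * N + i) (rev [0..<load m es v])) vs)))) \<le> S\<rbrakk>
    \<Longrightarrow> calls prog S 9 [list_val (map Atom vs), shared_val g m es, Atom N]
      (list_val (map Atom (concat (map (\<lambda>v. map (\<lambda>i. v * N + i) (rev [0..<load m es v])) vs))))
      ((30 * D + (30 * L + 40) * length es + 50) * length vs + 5)"
proof (induction vs)
  case Nil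
  show ?case by (rule run) (simp_all add: prog_nth verts_body_def)
next
  case (Cons v vs)
  let ?out = "\<lambda>vs. map Atom (concat (map (\<lambda>v. map (\<lambda>i. v * N + i) (rev [0..<load m es v])) vs))"
  have IH: "calls prog S 9 [list_val (map Atom vs), shared_val g m es, Atom N] (list_val (?out vs))
      ((30 * D + (30 * L + 40) * length es + 50) * length vs + 5)"
    by (rule Cons.IH) (use Cons.prems vsize_append in \<open>auto intro: order_trans\<close>)
  have deg: "calls prog S 2 [Atom v, shared_val g m es] (Atom (load m es v))
      ((30 * L + 40) * length es + 5)"
    by (rule calls_load) (use assms(1,2,4) assms(3)[rule_format, of v] in auto)
  have cps: "calls prog S 8 [Atom v, Atom (load m es v), Atom N, list_val (?out vs)]
      (list_val (map (\<lambda>i. Atom (v * N + i)) (rev [0..<load m es v]) @ ?out vs))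
      (30 * load m es v + 5)"
    by (rule calls_copies) (use Cons.prems in \<open>auto simp: comp_def\<close>)
  have out: "?out (v # vs) = map (\<lambda>i. Atom (v * N + i)) (rev [0..<load m es v]) @ ?out vs"
    by (simp add: comp_def)
  have "load m es v \<le> D" using assms(3) by simp
  then show ?case
    unfolding out
    by (intro run) (auto simp: prog_nth verts_body_def
        intro!: with_callI[OF IH] with_callI[OF deg] with_callI[OF cps])
qed

text \<open>\<open>r\<close> is the mass not yet assigned. Truncated subtraction satisfies
  \<open>r - a - b = r - (a + b)\<close> unconditionally, so passing the remainder along agrees with
  subtracting the whole sum at the end.\<close>

lemma calls_shares:
  "\<lbrakk>\<forall>e\<in>set (butlast es). m e = num e * N div den e;
    es \<noteq> [] \<Longrightarrow> m (last es) = r - (\<Sum>e\<leftarrow>butlast es. m e);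
    \<forall>e\<in>set es. num e * N \<le> B; vsize (shared_val g m es) \<le> S\<rbrakk> \<Longrightarrow>
    calls prog S 10 [weighted_val g num den es, Atom r, Atom N] (shared_val g m es)
      (30 * length es + 5)"
proof (induction es arbitrary: r)
  case Nil
  show ?case by (rule run) (simp_all add: prog_nth shares_body_def)
next
  case (Cons e es)
  have IH: "calls prog S 10 [weighted_val g num den es, Atom (r - m e), Atom N] (shared_val g m es)
      (30 * length es + 5)"
    by (rule Cons.IH) (use Cons.prems in \<open>auto split: if_splits\<close>)
  have empty: "weighted_val g num den es = Atom 0 \<longleftrightarrow> es = []"
    by (cases es) auto
  have size: "num e * N \<le> B" "vsize (shared_val g m (e # es)) \<le> S" using Cons.prems by auto
  show ?case
  proof (cases "es = []")
    case True
    then have r: "r = m e" using Cons.prems(2) by simp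
    show ?thesis
      using size
      by (intro run) (auto simp: True r prog_nth shares_body_def atom_size
          intro!: with_callI[OF IH[unfolded True r, simplified]])
  next
    case False
    then have "num e * N div den e = m e" using Cons.prems(1) by simp
    then show ?thesis
      using False size
      by (intro run) (auto simp: prog_nth shares_body_def empty atom_size
          intro!: with_callI[OF IH])
  qed
qed

lemma calls_fact: "fact n \<le> B \<Longrightarrow> calls prog S 11 [Atom n] (Atom (fact n)) (20 * n + 5)"
proof (induction n)
  case 0
  show ?case by (rule run) (simp_all add: prog_nth fact_body_def)
next
  case (Suc n)
  have "fact n \<le> (fact (Suc n) :: nat)" by (rule fact_mono) simp
  then have "fact n \<le> B" using Suc.prems by (rule order_trans)
  then have IH: "calls prog S 11 [Atom n] (Atom (fact n)) (20 * n + 5)" by (rule Suc.IH)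
  show ?case
    using Suc.prems
    by (intro run) (auto simp: prog_nth fact_body_def atom_size intro!: with_callI[OF IH])
qed

end

section \<open>Intervals of constant phases\<close>

lemma sorted_wrt_comparable:
  "sorted_wrt P xs \<Longrightarrow> p \<in> set xs \<Longrightarrow> q \<in> set xs \<Longrightarrow> p = q \<or> P p q \<or> P q p"
  by (induction xs) auto

lemma sum_list_strict_mono_ex1:
  fixes f g :: "'a \<Rightarrow> nat"
  assumes "\<And>x. x \<in> set xs \<Longrightarrow> f x \<le> g x" "\<exists>x\<in>set xs. f x < g x"
  shows "(\<Sum>x\<leftarrow>xs. f x) < (\<Sum>x\<leftarrow>xs. g x)"
proof -
  obtain x ys zs where xs: "xs = ys @ x # zs" "f x < g x" using assms(2) by (meson split_list)
  have "(\<Sum>x\<leftarrow>ys. f x) \<le> (\<Sum>x\<leftarrow>ys. g x)" "(\<Sum>x\<leftarrow>zs. f x) \<le> (\<Sum>x\<leftarrow>zs. g x)"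
    using assms(1) xs(1) by (auto intro!: sum_list_mono)
  then show ?thesis using xs by simp
qed

lemma count_list_distinct: "distinct xs \<Longrightarrow> count_list xs x = (if x \<in> set xs then 1 else 0)"
  by (induction xs) auto

lemma next_phase_le: "next_phase W e r R \<le> R"
proof (induction e arbitrary: R)
  case (Cons v e)
  show ?case using Cons[of "min R (Suc (r div W v) * W v)"] by simp
qed simp

lemma next_phase_le_slot: "v \<in> set e \<Longrightarrow> next_phase W e r R \<le> Suc (r div W v) * W v"
proof (induction e arbitrary: R)
  case (Cons u e)
  show ?case
  proof (cases "u = v")
    case True
    then show ?thesis
      using next_phase_le[of W e r "min R (Suc (r div W v) * W v)"] by simp
  qed (use Cons in auto)
qed simp

lemma next_phase_cases:
  "next_phase W e r R = R \<or> (\<exists>v\<in>set e. next_phase W e r R = Suc (r div W v) * W v)"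
proof (induction e arbitrary: R)
  case (Cons u e)
  show ?case
    using Cons[of "min R (Suc (r div W u) * W u)"] by (auto simp: min_def split: if_splits)
qed simp

text \<open>The block ends of all vertices of one edge cut the phases into intervals. Divisibility
  makes \<open>R\<close> a common block end.\<close>

locale phases =
  fixes W :: "nat \<Rightarrow> nat" and e :: "nat list" and R :: nat
  assumes nonempty: "e \<noteq> []" and width: "v \<in> set e \<Longrightarrow> W v dvd R" and R_pos: "0 < R"
begin

abbreviation nxt :: "nat \<Rightarrow> nat" where
  "nxt r \<equiv> next_phase W e r R"

lemma W_pos: "v \<in> set e \<Longrightarrow> 0 < W v"
  using width R_pos by (metis dvd_0_left neq0_conv)

lemma slot_end_le:
  assumes "r < R" "v \<in> set e"
  shows "Suc (r div W v) * W v \<le> R"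
proof -
  obtain k where k: "R = W v * k" using width[OF assms(2)] by (elim dvdE)
  then have "r div W v < k" using assms W_pos[OF assms(2)]
    by (metis less_mult_imp_div_less mult.commute)
  then show ?thesis using k by (metis Suc_leI mult.commute mult_le_mono1)
qed

lemma nxt_gt:
  assumes "r < R"
  shows "r < nxt r"
proof -
  have "r < Suc (r div W v) * W v" if "v \<in> set e" for v
    using W_pos[OF that] by (simp add: dividend_less_div_times add.commute)
  then show ?thesis using next_phase_cases[of W e r R] assms by auto
qed

text \<open>The cap \<open>R\<close> is itself never exceeded by a block end, so with at least one
  vertex the minimum is always a genuine block end, even at the last interval.\<close>

lemma nxt_attained:
  assumes "r < R"
  obtains v where "v \<in> set e" "nxt r = Suc (r div W v) * W v"
proof -
  obtain u where u: "u \<in> set e" using nonempty by (meson list.set_sel(1))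
  have "\<exists>v\<in>set e. nxt r = Suc (r div W v) * W v"
    using next_phase_cases[of W e r R] next_phase_le_slot[OF u, of W r R] slot_end_le[OF assms u] u
    by (metis antisym)
  then show ?thesis using that by blast
qed

lemma slot_const:
  assumes "q \<le> u" "u < nxt q" "v \<in> set e"
  shows "u div W v = q div W v"
proof -
  have "u < Suc (q div W v) * W v"
    using assms next_phase_le_slot[OF assms(3)] by (meson less_le_trans)
  then have "u div W v < Suc (q div W v)" by (rule less_mult_imp_div_less)
  then show ?thesis using div_le_mono[OF assms(1), of "W v"] by linarith
qed

text \<open>At \<open>nxt q\<close> the block of some vertex ends, and by monotonicity of division
  its slot never returns to the old value.\<close>

lemma slot_changes:
  assumes "q < R" "nxt q \<le> u"
  shows "\<exists>v\<in>set e. q div W v < u div W v"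
proof -
  obtain v where v: "v \<in> set e" "nxt q = Suc (q div W v) * W v" using nxt_attained[OF assms(1)] .
  have "Suc (q div W v) \<le> u div W v"
    using div_le_mono[OF assms(2), of "W v"] v W_pos[OF v(1)] by simp
  then show ?thesis by (intro bexI[OF _ v(1)]) simp
qed

lemma orbit_range: "q \<in> set (orbit nxt R r) \<Longrightarrow> r \<le> q \<and> q < R"
proof (induction "R - r" arbitrary: r rule: less_induct)
  case less
  then show ?case
    using orbit.simps[of nxt R r] nxt_gt[of r]
    by (cases "r < R") (auto dest!: less.hyps[rotated])
qed

lemma orbit_sorted: "sorted_wrt (\<lambda>q u. nxt q \<le> u) (orbit nxt R r)"
proof (induction "R - r" arbitrary: r rule: less_induct)
  case less
  show ?case
  proof (cases "r < R")
    case True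
    then have "sorted_wrt (\<lambda>q u. nxt q \<le> u) (orbit nxt R (nxt r))"
      using nxt_gt[OF True] by (intro less) auto
    then show ?thesis
      using True nxt_gt[OF True] orbit.simps[of nxt R r] orbit_range by auto
  qed (simp add: orbit.simps)
qed

lemma orbit_covers: "r \<le> u \<Longrightarrow> u < R \<Longrightarrow> \<exists>q\<in>set (orbit nxt R r). q \<le> u \<and> u < nxt q"
proof (induction "R - r" arbitrary: r rule: less_induct)
  case less
  then have r: "r < R" by simp
  then have orb: "orbit nxt R r = r # orbit nxt R (nxt r)"
    using nxt_gt orbit.simps[of nxt R r] by simp
  show ?case
  proof (cases "u < nxt r")
    case False
    then have "\<exists>q\<in>set (orbit nxt R (nxt r)). q \<le> u \<and> u < nxt q"
      using nxt_gt[OF r] less.prems r by (intro less.hyps) auto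
    then show ?thesis using orb by auto
  qed (use orb less.prems in auto)
qed

text \<open>Potential argument: the sum of the slots of all vertices grows with every jump, and it
  is at most its value at \<open>R\<close>.\<close>

lemma orbit_length:
  "length (orbit nxt R r) + (\<Sum>v\<leftarrow>e. r div W v) \<le> (\<Sum>v\<leftarrow>e. R div W v) \<or> R \<le> r"
proof (induction "R - r" arbitrary: r rule: less_induct)
  case less
  show ?case
  proof (cases "r < R")
    case r: True
    have le: "nxt r \<le> R" by (rule next_phase_le)
    have orb: "orbit nxt R r = r # orbit nxt R (nxt r)"
      using r nxt_gt orbit.simps[of nxt R r] by simp
    have tail: "length (orbit nxt R (nxt r)) + (\<Sum>v\<leftarrow>e. nxt r div W v) \<le> (\<Sum>v\<leftarrow>e. R div W v)"
    \<comment> \<open>At \<open>R\<close> the induction hypothesis holds trivially and says nothing,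
      but there the orbit is empty.\<close>
    proof (cases "nxt r = R")
      case True
      then show ?thesis by (simp add: orbit.simps)
    next
      case False
      then show ?thesis using less[of "nxt r"] nxt_gt[OF r] r le by auto
    qed
    obtain v where v: "v \<in> set e" "r div W v < nxt r div W v"
      using slot_changes[OF r order_refl] by blast
    have "(\<Sum>v\<leftarrow>e. r div W v) < (\<Sum>v\<leftarrow>e. nxt r div W v)"
      using v nxt_gt[OF r] by (intro sum_list_strict_mono_ex1 div_le_mono) auto
    then show ?thesis using tail orb by simp
  qed simp
qed

lemma orbit_length_le: "length (orbit nxt R 0) \<le> (\<Sum>v\<leftarrow>e. R div W v)"
  using orbit_length[of 0] R_pos by auto

text \<open>A tuple of slots never recurs. If \<open>r\<close> lies in the interval of
  \<open>p\<close> and shares all slots with \<open>q\<close>, then so does \<open>p\<close>; were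
  \<open>p\<close> and \<open>q\<close> different, one interval would end before the other starts,
  and some slot would have grown in between.\<close>

lemma orbit_class:
  assumes q: "q \<in> set (orbit nxt R 0)" and r: "r < R"
  shows "(\<forall>v\<in>set e. r div W v = q div W v) \<longleftrightarrow> q \<le> r \<and> r < nxt q"
proof
  assume same: "\<forall>v\<in>set e. r div W v = q div W v"
  have qR: "q < R" using orbit_range[OF q] by simp
  obtain p where p: "p \<in> set (orbit nxt R 0)" "p \<le> r" "r < nxt p"
    using orbit_covers[of 0 r] r by auto
  have "\<forall>v\<in>set e. p div W v = q div W v"
    using slot_const[OF p(2,3)] same by metis
  moreover have "\<not> nxt p \<le> q \<and> \<not> nxt q \<le> p"
    using calculation slot_changes[of p q] slot_changes[of q p] qR orbit_range[OF p(1)]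
    by (metis less_irrefl)
  ultimately have "p = q"
    using sorted_wrt_comparable[OF orbit_sorted p(1) q] by blast
  then show "q \<le> r \<and> r < nxt q" using p by simp
qed (use slot_const in auto)

lemma orbit_distinct: "distinct (orbit nxt R 0)"
proof -
  have "sorted_wrt (<) (orbit nxt R 0)"
    by (rule sorted_wrt_mono_rel[OF _ orbit_sorted])
       (use orbit_range nxt_gt in \<open>auto intro: less_le_trans\<close>)
  then show ?thesis by (simp add: strict_sorted_iff)
qed

end

section \<open>Encoded instances\<close>

locale encoded =
  fixes d :: nat and H :: "nat hyper_unique_games" and vs :: "nat list" and es :: "nat list list"
    and num den :: "nat list \<Rightarrow> nat"
  assumes inst': "hug_instance d H"
    and vs: "distinct vs" "set vs = verts H"
    and es: "distinct es" "set es = edges H"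
    and weights: "\<forall>e\<in>edges H. 0 < den e \<and> pmf (weight H) e = real (num e) / real (den e)"
begin

lemma es_nonempty: "es \<noteq> []"
  using inst' es(2) set_pmf_not_empty[of "weight H"] by (auto simp: hug_instance_def)

sublocale regularization d H "last es"
  using inst' last_in_set[OF es_nonempty] unfolding es(2) by (rule regularization.intro)

lemma grid_length: "grid = length vs * length es"
  unfolding grid_def using vs es by (metis distinct_card)

lemma load_share: "load share es v = num_copies v"
proof -
  have "load share es v = (\<Sum>e\<in>edges H. count_list e v * share e)"
    unfolding load_def es(2)[symmetric] by (rule sum_list_distinct_conv_sum_set[OF es(1)])
  also have "\<dots> = (\<Sum>e\<in>edges H. if v \<in> set e then share e else 0)"
    using edge by (intro sum.cong) (auto simp: count_list_distinct)
  also have "\<dots> = num_copies v"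
    unfolding num_copies_def using finite_edges by (simp add: sum.inter_filter)
  finally show ?thesis .
qed

lemma rounded_down_fraction: "e \<in> edges H \<Longrightarrow> rounded_down e = num e * grid div den e"
  using weights unfolding rounded_down_def
  by (simp flip: of_nat_mult add: floor_divide_of_nat_eq)

lemma share_butlast: "e \<in> set (butlast es) \<Longrightarrow> share e = num e * grid div den e"
proof -
  assume e: "e \<in> set (butlast es)"
  have "distinct (butlast es @ [last es])" using es(1) es_nonempty by simp
  then have "e \<noteq> last es" using e by auto
  then show ?thesis using e es(2) in_set_butlastD[OF e] by (simp add: share_def rounded_down_fraction)
qed

lemma share_last: "share (last es) = grid - (\<Sum>e\<leftarrow>butlast es. share e)"
proof -
  have dist: "distinct (butlast es @ [last es])" using es(1) es_nonempty by simp
  have "set (butlast es @ [last es]) = edges H" using es es_nonempty by simp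
  then have "edges H - {last es} = set (butlast es)" using dist by auto
  moreover have "(\<Sum>e\<leftarrow>butlast es. share e) = (\<Sum>e\<in>set (butlast es). rounded_down e)"
    using es dist
    by (auto simp: sum_list_distinct_conv_sum_set share_butlast rounded_down_fraction
        dest!: in_set_butlastD intro!: sum.cong)
  ultimately show ?thesis by (simp add: share_def)
qed

section \<open>The code of the new instance\<close>

definition tables :: "nat list \<Rightarrow> nat \<Rightarrow> val" where
  "tables e v = list_val (map (\<lambda>a. Atom (perm H e v a)) [0..<num_labels H])"

definition orbit_of :: "nat list \<Rightarrow> nat list" where
  "orbit_of e = orbit (\<lambda>r. next_phase width e r period) period 0"

definition new_verts :: "nat list" where
  "new_verts = concat (map (\<lambda>v. map (\<lambda>i. v * grid + i) (rev [0..<num_copies v])) vs)"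

definition new_edges :: "nat list list" where
  "new_edges = concat (map (\<lambda>e. if share e = 0 then [] else map (lift e) (orbit_of e)) es)"

definition new_code :: val where
  "new_code = Cell (list_val (map Atom new_verts)) (Cell (Atom (num_labels H))
     (list_val (edges_vals width tables share period grid es)))"

lemma phases_edge: "e \<in> edges H \<Longrightarrow> 0 < share e \<Longrightarrow> phases width e period"
proof
  assume e: "e \<in> edges H" "0 < share e"
  show "e \<noteq> []" using edge[OF e(1)] d_pos by auto
  show "width v dvd period" if "v \<in> set e" for v
    using num_copies_width[OF num_copies_pos[OF e(1) that e(2)]] by (metis dvd_triv_right)
  show "0 < period" by (rule period_pos)
qed

lemma lift_eq_iff: "lift e r = lift e q \<longleftrightarrow> (\<forall>v\<in>set e. r div width v = q div width v)"
  by (simp add: lift_def copy_def)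

lemma lift_eq_orbit:
  assumes "e \<in> edges H" "0 < share e" "q \<in> set (orbit_of e)" "r < period"
  shows "lift e r = lift e q \<longleftrightarrow> q \<le> r \<and> r < next_phase width e q period"
proof -
  interpret phases width e period using assms(1,2) by (rule phases_edge)
  show ?thesis unfolding lift_eq_iff using assms(3,4) orbit_class by (simp add: orbit_of_def)
qed

lemma card_phase:
  assumes "e \<in> edges H" "0 < share e" "q \<in> set (orbit_of e)"
  shows "card {r. r < period \<and> lift e r = lift e q} = next_phase width e q period - q"
proof -
  have "{r. r < period \<and> lift e r = lift e q} = {q..<next_phase width e q period}"
    using lift_eq_orbit[OF assms] next_phase_le[of width e q period] by auto
  then show ?thesis by simp
qed

lemma orbit_of_less: "e \<in> edges H \<Longrightarrow> 0 < share e \<Longrightarrow> q \<in> set (orbit_of e) \<Longrightarrow> q < period"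
  using phases.orbit_range[OF phases_edge] unfolding orbit_of_def by blast

lemma lift_orbit: "e \<in> edges H \<Longrightarrow> 0 < share e \<Longrightarrow> lift e ` set (orbit_of e) = lift e ` {..<period}"
proof (intro equalityI subsetI)
  fix x assume e: "e \<in> edges H" "0 < share e" and "x \<in> lift e ` {..<period}"
  then obtain r where r: "r < period" "x = lift e r" by auto
  then obtain q where "q \<in> set (orbit_of e)" "q \<le> r \<and> r < next_phase width e q period"
    using phases.orbit_covers[OF phases_edge[OF e], of 0 r] unfolding orbit_of_def by auto
  then show "x \<in> lift e ` set (orbit_of e)" using lift_eq_orbit[OF e] r by blast
qed (use orbit_of_less in blast)

lemma lift_orbit_inj: "e \<in> edges H \<Longrightarrow> 0 < share e \<Longrightarrow> inj_on (lift e) (set (orbit_of e))"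
proof (rule inj_onI)
  fix q u
  assume e: "e \<in> edges H" "0 < share e" and q: "q \<in> set (orbit_of e)" and u: "u \<in> set (orbit_of e)"
    and eq: "lift e q = lift e u"
  have "u \<le> q" using lift_eq_orbit[OF e u orbit_of_less[OF e q]] eq by simp
  moreover have "q \<le> u" using lift_eq_orbit[OF e q orbit_of_less[OF e u]] eq by simp
  ultimately show "q = u" by simp
qed

lemma set_new_verts: "set new_verts = verts regular"
  by (simp add: new_verts_def regular_def vs lessThan_atLeast0)

text \<open>Distinctness by counting: the list has no more entries than its set has
  elements.\<close>

lemma distinct_new_verts: "distinct new_verts"
proof -
  have "card (set new_verts) = (\<Sum>v\<in>verts H. num_copies v)"
    unfolding set_new_verts card_copies num_copies_def
    using sum_incident[OF finite_verts finite_edges edge, of share] by (simp add: sum_share)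
  also have "\<dots> = length new_verts"
    using vs by (simp add: new_verts_def length_concat comp_def sum_list_distinct_conv_sum_set)
  finally show ?thesis by (rule card_distinct)
qed

lemma set_new_edges: "set new_edges = edges regular"
proof -
  have "set new_edges = (\<Union>e\<in>{e \<in> edges H. 0 < share e}. lift e ` set (orbit_of e))"
    by (auto simp: new_edges_def es split: if_splits)
  also have "\<dots> = (\<Union>e\<in>{e \<in> edges H. 0 < share e}. lift e ` {..<period})"
    by (intro SUP_cong) (auto simp: lift_orbit)
  finally show ?thesis by (auto simp: regular_def set_new_weight)
qed

text \<open>Within one edge, different intervals give different tuples; across edges, division by
  \<open>grid\<close> tells the tuples apart.\<close>

lemma distinct_new_edges: "distinct new_edges"
proof -
  have "distinct (concat (map (\<lambda>e. if share e = 0 then [] else map (lift e) (orbit_of e)) fs))"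
    if "distinct fs" "set fs \<subseteq> edges H" for fs
    using that
  proof (induction fs)
    case (Cons e fs)
    have "distinct (map (lift e) (orbit_of e))" if "0 < share e"
      using phases.orbit_distinct[OF phases_edge[OF _ that]] lift_orbit_inj[OF _ that] Cons.prems
      by (simp add: distinct_map orbit_of_def)
    moreover have "lift e q \<noteq> lift f u"
      if "f \<in> set fs" "0 < share e" "0 < share f" "q \<in> set (orbit_of e)" "u \<in> set (orbit_of f)" for f q u
    proof -
      have "q < period" "u < period" "e \<noteq> f" using that orbit_of_less Cons.prems by auto
      then show ?thesis using map_div_lift[of q e] map_div_lift[of u f] by metis
    qed
    ultimately show ?case using Cons by (fastforce split: if_splits)
  qed simp
  then show ?thesis unfolding new_edges_def using es by simp
qed

text \<open>A code requires the numerator as a function of the new edge alone, so the original edge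
  is recovered by division.\<close>

definition new_num :: "nat list \<Rightarrow> nat" where
  "new_num x = (let e = map (\<lambda>u. u div grid) x in share e * card {r. r < period \<and> lift e r = x})"

lemma encodes_new_code: "encodes new_code regular"
proof -
  let ?cell = "\<lambda>x. Cell
      (list_val (map (\<lambda>v. Cell (Atom v)
        (list_val (map (\<lambda>a. Atom (perm regular x v a)) [0..<num_labels regular]))) x))
      (Cell (Atom (new_num x)) (Atom (grid * period)))"
  have cell: "phase_val width (tables e) e period (share e) grid q = ?cell (lift e q)"
    if e: "e \<in> edges H" "0 < share e" and q: "q \<in> set (orbit_of e)" for e q
  proof -
    have qp: "q < period" by (rule orbit_of_less[OF e q])
    have "map (\<lambda>v. Cell (Atom (v * grid + q div width v)) (tables e v)) e
      = map (\<lambda>v. Cell (Atom v)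
        (list_val (map (\<lambda>a. Atom (perm regular (lift e q) v a)) [0..<num_labels regular]))) (lift e q)"
      using copy_div[OF qp] map_div_lift[OF qp, of e]
      by (simp add: lift_def tables_def regular_def) (simp add: copy_def)
    then show ?thesis
      using map_div_lift[OF qp, of e] card_phase[OF e q]
      by (simp add: phase_val_def new_num_def Let_def)
  qed
  have "edges_vals width tables share period grid es = map ?cell new_edges"
    unfolding edges_vals_def new_edges_def map_concat map_map orbit_of_def[symmetric]
    using cell es by (intro arg_cong[where f = concat] map_cong) auto
  then have "new_code = Cell (list_val (map Atom new_verts)) (Cell (Atom (num_labels regular))
      (list_val (map ?cell new_edges)))"
    by (simp add: new_code_def regular_def)
  moreover have "0 < grid * period
      \<and> pmf (weight regular) x = real (new_num x) / real (grid * period)" if "x \<in> edges regular" for x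
  proof -
    obtain e r where e: "e \<in> edges H" "r < period" "x = lift e r"
      using \<open>x \<in> edges regular\<close> by (auto simp: regular_def set_new_weight)
    then show ?thesis
      using pmf_new_weight[OF e(1,2)] map_div_lift[OF e(2), of e] grid_pos period_pos
      by (simp add: regular_def new_num_def Let_def)
  qed
  ultimately show ?thesis
    unfolding encodes_def
    using distinct_new_verts set_new_verts distinct_new_edges set_new_edges
    by (intro exI[of _ new_verts] exI[of _ new_edges] exI[of _ new_num]
        exI[of _ "\<lambda>_. grid * period"] conjI ballI) auto
qed

text \<open>A vertex contributes one block end per copy, hence at most \<open>grid\<close>, and the
  edge has \<open>d\<close> vertices.\<close>

lemma length_orbit_of_le: "e \<in> edges H \<Longrightarrow> 0 < share e \<Longrightarrow> length (orbit_of e) \<le> d * grid"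
proof -
  assume e: "e \<in> edges H" "0 < share e"
  have "length (orbit_of e) \<le> (\<Sum>v\<leftarrow>e. period div width v)"
    using phases.orbit_length_le[OF phases_edge[OF e]] unfolding orbit_of_def .
  also have "\<dots> \<le> (\<Sum>v\<leftarrow>e. grid)"
  proof (rule sum_list_mono)
    fix v assume "v \<in> set e"
    then have "0 < num_copies v" using num_copies_pos e by simp
    then have "period div width v = num_copies v"
      using num_copies_width[of v] width_pos[of v] by (metis nonzero_mult_div_cancel_right neq0_conv)
    then show "period div width v \<le> grid" using num_copies_le_grid by simp
  qed
  also have "\<dots> = d * grid" using edge[OF e(1)] by (simp add: sum_list_triv)
  finally show ?thesis .
qed

end

section \<open>Polynomial size bounds\<close>

lemma calls_mono: "calls F S f us v n \<Longrightarrow> n \<le> n' \<Longrightarrow> calls F S f us v n'"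
  unfolding calls_def by (meson mult_le_mono1 order_trans)

lemma vsize_member: "x \<in> set xs \<Longrightarrow> vsize x < vsize (list_val xs)"
  by (induction xs) auto

lemma length_less_vsize: "length xs < vsize (list_val xs)"
  by (induction xs) (auto simp: vsize.simps(1))

lemma vsize_list_le:
  assumes "\<And>x. x \<in> set xs \<Longrightarrow> vsize x \<le> b" "length xs \<le> n"
  shows "vsize (list_val xs) \<le> 1 + n * (1 + b)"
proof -
  have "vsize (list_val xs) \<le> 1 + length xs * (1 + b)" using assms(1)
  proof (induction xs)
    case (Cons x xs)
    have "vsize x \<le> b" by (rule Cons.prems) simp
    moreover have "vsize (list_val xs) \<le> 1 + length xs * (1 + b)"
      by (rule Cons.IH) (simp add: Cons.prems)
    ultimately show ?case by simp
  qed (simp add: vsize.simps(1) floorlog_eq_zero_iff)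
  also have "\<dots> \<le> 1 + n * (1 + b)" using assms(2) by (intro add_left_mono mult_le_mono1)
  finally show ?thesis .
qed

lemma less_two_power_vsize: "n < 2 ^ vsize (Atom n)"
proof -
  have "n < 2 ^ floorlog 2 n" by (rule floorlog_leD) auto
  also have "(2::nat) ^ floorlog 2 n \<le> 2 ^ vsize (Atom n)"
    by (rule power_increasing) (simp_all add: vsize.simps(1))
  finally show ?thesis .
qed

text \<open>With these facts, comparisons of polynomials in \<open>s\<close> become linear in the
  powers of \<open>s\<close>.\<close>

lemma power_bounds:
  fixes s :: nat
  assumes "1 \<le> s"
  shows "1 \<le> s ^ 9" "s ^ 4 \<le> s ^ 5" "s ^ 5 \<le> s ^ 9" "s ^ 7 \<le> s ^ 9" "s \<le> s ^ 5"
    "s ^ 2 \<le> s ^ 5" "s ^ 3 \<le> s ^ 5" "1 \<le> s ^ 5" "s * s \<le> s ^ 5" "s * s ^ 4 = s ^ 5"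
    "s ^ 3 \<le> s ^ 7" "s ^ 4 \<le> s ^ 9" "s ^ 3 * s ^ 4 = s ^ 7" "s ^ 4 * s ^ 5 = s ^ 9" "s \<le> s ^ 9"
    "1 \<le> s ^ 7"
proof -
  have up: "s ^ i \<le> s ^ j" if "i \<le> j" for i j using assms that by (rule power_increasing[rotated])
  show "1 \<le> s ^ 9" "s ^ 4 \<le> s ^ 5" "s ^ 5 \<le> s ^ 9" "s ^ 7 \<le> s ^ 9" "s \<le> s ^ 5" "s ^ 2 \<le> s ^ 5"
    "s ^ 3 \<le> s ^ 5" "1 \<le> s ^ 5" "s * s \<le> s ^ 5" "s ^ 3 \<le> s ^ 7" "s ^ 4 \<le> s ^ 9" "s \<le> s ^ 9"
    "1 \<le> s ^ 7"
    using up[of 0 9] up[of 4 5] up[of 5 9] up[of 7 9] up[of 1 5] up[of 2 5] up[of 3 5] up[of 0 5]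
      up[of 3 7] up[of 4 9] up[of 1 9] up[of 0 7]
    by (simp_all only: power_0 power_one_right power2_eq_square)
  show "s * s ^ 4 = s ^ 5" "s ^ 3 * s ^ 4 = s ^ 7" "s ^ 4 * s ^ 5 = s ^ 9"
    by (simp_all flip: power_add power_Suc)
qed

context encoded
begin

definition code :: val where
  "code = Cell (list_val (map Atom vs)) (Cell (Atom (num_labels H)) (weighted_val tables num den es))"

abbreviation s :: nat where
  "s \<equiv> vsize code"

lemma vsize_verts: "vsize (list_val (map Atom vs)) \<le> s"
  and vsize_edges: "vsize (weighted_val tables num den es) \<le> s"
  and vsize_labels: "vsize (Atom (num_labels H)) \<le> s"
  by (simp_all add: code_def)

lemma s_pos: "1 \<le> s"
  by (simp add: code_def)

lemma length_vs: "length vs \<le> s"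
  using length_less_vsize[of "map Atom vs"] vsize_verts by simp

lemma length_es: "length es \<le> s"
proof -
  have "length es < vsize (weighted_val tables num den es)"
    unfolding weighted_val_def by (rule le_less_trans[OF _ length_less_vsize]) simp
  then show ?thesis using vsize_edges by linarith
qed

lemma vert_less: "v \<in> verts H \<Longrightarrow> v < 2 ^ s"
proof -
  assume "v \<in> verts H"
  then have "vsize (Atom v) < vsize (list_val (map Atom vs))" using vs by (intro vsize_member) auto
  then have "(2::nat) ^ vsize (Atom v) \<le> 2 ^ s" using vsize_verts by (intro power_increasing) auto
  then show ?thesis using less_two_power_vsize[of v] by linarith
qed

lemma edge_sizes:
  assumes "e \<in> edges H"
  shows "vsize (table_val (tables e) e) \<le> s" "vsize (Atom (num e)) \<le> s" "length e \<le> s"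
    and "v \<in> set e \<Longrightarrow> vsize (Cell (Atom v) (tables e v)) \<le> s"
proof -
  have "vsize (Cell (table_val (tables e) e) (Cell (Atom (num e)) (Atom (den e)))) < s"
    using assms es(2) vsize_edges unfolding weighted_val_def
    by (intro less_le_trans[OF vsize_member]) auto
  then show table: "vsize (table_val (tables e) e) \<le> s" and "vsize (Atom (num e)) \<le> s" by simp_all
  have "length e < vsize (table_val (tables e) e)"
    unfolding table_val_def by (rule le_less_trans[OF _ length_less_vsize]) simp
  then show "length e \<le> s" using table by linarith
  show "vsize (Cell (Atom v) (tables e v)) \<le> s" if "v \<in> set e"
  proof -
    have "vsize (Cell (Atom v) (tables e v)) < vsize (table_val (tables e) e)"
      unfolding table_val_def using that by (intro vsize_member) auto
    then show ?thesis using table by linarith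
  qed
qed

lemma num_less: "e \<in> edges H \<Longrightarrow> num e < 2 ^ s"
proof -
  assume "e \<in> edges H"
  then have "(2::nat) ^ vsize (Atom (num e)) \<le> 2 ^ s"
    using edge_sizes(2) by (intro power_increasing) auto
  then show ?thesis using less_two_power_vsize[of "num e"] by linarith
qed

lemma d_le: "d \<le> s"
  using edge_sizes(3) edge[OF e0] e0 by auto

lemma grid_le: "grid \<le> s ^ 2"
  unfolding grid_length power2_eq_square by (intro mult_le_mono length_vs length_es)

text \<open>Vertices and weight numerators of the input are below \<open>2 ^ s\<close>, names of
  copies stay within \<open>2 ^ s * grid\<close>, and new weights are built from numbers up to
  \<open>grid * period\<close>. As all factors are positive, the product covers every case.\<close>

definition bound :: nat where
  "bound = 2 ^ s * grid * period"

lemma le_boundI: "a \<le> 2 ^ s \<Longrightarrow> b \<le> grid \<Longrightarrow> c \<le> period \<Longrightarrow> a * b * c \<le> bound"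
  unfolding bound_def by (intro mult_le_mono)

text \<open>The factorial is at most \<open>grid ^ grid\<close>, hence at most
  \<open>2 ^ (grid * grid)\<close>, and \<open>grid * grid\<close> is at most \<open>s ^ 4\<close>.
  This is the dominant term of the bit length.\<close>

lemma vsize_bound: "vsize (Atom bound) \<le> 4 * s ^ 4"
proof -
  have "grid < 2 ^ grid" by simp
  have "period \<le> grid ^ grid" unfolding period_def using fact_le_power[of grid, where ?'a = nat] by simp
  also have "\<dots> \<le> (2 ^ grid) ^ grid" by (intro power_mono) (auto intro: less_imp_le)
  finally have "period \<le> 2 ^ (grid * grid)" by (simp add: power_mult)
  then have "2 ^ s * grid * period \<le> 2 ^ s * grid * 2 ^ (grid * grid)" by (intro mult_le_mono) auto
  also have "\<dots> < 2 ^ s * 2 ^ grid * 2 ^ (grid * grid)" using \<open>grid < 2 ^ grid\<close> by simp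
  finally have "bound < 2 ^ (s + grid + grid * grid)" by (simp add: bound_def power_add)
  then have "floorlog 2 bound \<le> s + grid + grid * grid" by (intro floorlog_leI) auto
  then have "vsize (Atom bound) \<le> 1 + s + grid + grid * grid" by (simp add: vsize.simps(1))
  also have "\<dots> \<le> 1 + s + s ^ 2 + s ^ 2 * s ^ 2" using grid_le by (intro add_mono mult_le_mono) auto
  also have "\<dots> \<le> s ^ 4 + s ^ 4 + s ^ 4 + s ^ 4"
    using s_pos power_increasing[of 1 4 s] power_increasing[of 2 4 s] one_le_power[of s 4]
    by (intro add_mono) (auto simp flip: power_add)
  finally show ?thesis by simp
qed

lemmas powers = power_bounds[OF s_pos]

text \<open>The largest value is the output: edges of total size at most \<open>20 * s ^ 9\<close>,
  vertices of total size at most \<open>6 * s ^ 7\<close>, and lower-order terms.\<close>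

abbreviation budget_size :: nat where
  "budget_size \<equiv> 30 * s ^ 9"

sublocale budget budget_size bound
proof
  show "2 \<le> budget_size" using powers(1) by linarith
  show "vsize (Atom bound) \<le> budget_size" using vsize_bound powers by linarith
qed

lemma vsize_le_bound: "n \<le> bound \<Longrightarrow> vsize (Atom n) \<le> 4 * s ^ 4"
  using vsize_bound floorlog_mono[of n bound 2] by (simp add: vsize.simps(1))

lemma grid_le_bound: "grid \<le> bound"
  using le_boundI[of 1 grid 1] period_pos by simp

lemma period_le_bound: "period \<le> bound"
  using le_boundI[of 1 1 period] grid_pos by simp

lemma grid_period_le_bound: "grid * period \<le> bound"
  using le_boundI[of 1 grid period] by simp

lemma s_le_bound: "s \<le> bound"
proof -
  have "2 ^ s \<le> bound" using le_boundI[of "2 ^ s" 1 1] grid_pos period_pos by simp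
  then show ?thesis by (rule order_trans[OF less_imp_le[OF less_exp]])
qed

lemma copy_le_bound: "v \<in> verts H \<Longrightarrow> i \<le> grid \<Longrightarrow> v * grid + i \<le> bound"
proof -
  assume "v \<in> verts H" "i \<le> grid"
  then have "v * grid + i \<le> Suc v * grid" by simp
  also have "\<dots> \<le> bound"
    using le_boundI[of "Suc v" grid 1] vert_less[OF \<open>v \<in> verts H\<close>] period_pos by simp
  finally show ?thesis .
qed

lemma share_le_grid: "e \<in> edges H \<Longrightarrow> share e \<le> grid"
  using member_le_sum[of e "edges H" share] finite_edges sum_share by simp

lemma vsize_shared: "vsize (shared_val tables share es) \<le> 8 * s ^ 5"
proof -
  have "vsize (shared_val tables share es) \<le> 1 + s * (1 + (1 + s + 4 * s ^ 4))"
  proof -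
    have "vsize (Cell (table_val (tables e) e) (Atom (share e))) \<le> 1 + s + 4 * s ^ 4"
      if "e \<in> set es" for e
      using that es(2) edge_sizes(1)[of e] vsize_le_bound[of "share e"] share_le_grid[of e] grid_le_bound
      by simp
    then show ?thesis
      unfolding shared_val_def using length_es by (intro vsize_list_le) auto
  qed
  \<comment> \<open>The expanded left side is 1 + 2s + s^2 + 4s^5, and 8 is the sum of its
    coefficients. The similar constants below also come from estimating lower powers by the highest
    one.\<close>
  also have "\<dots> \<le> 8 * s ^ 5" using powers by (simp add: distrib_left)
  finally show ?thesis .
qed

lemma width_le: "width v \<le> period"
  by (simp add: width_def)

lemma vsize_widths:
  assumes "e \<in> edges H"
  shows "vsize (width_val width (tables e) e) \<le> 8 * s ^ 5"
proof -
  have "vsize (width_val width (tables e) e) \<le> 1 + s * (1 + (1 + s + 4 * s ^ 4))"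
  proof -
    have "vsize (Cell (Cell (Atom v) (tables e v)) (Atom (width v))) \<le> 1 + s + 4 * s ^ 4"
      if "v \<in> set e" for v
      using edge_sizes(4)[OF assms that] vsize_le_bound[of "width v"] width_le[of v] period_le_bound
      by simp
    then show ?thesis
      unfolding width_val_def using edge_sizes(3)[OF assms] by (intro vsize_list_le) auto
  qed
  also have "\<dots> \<le> 8 * s ^ 5" using powers by (simp add: distrib_left)
  finally show ?thesis .
qed

lemma size_le: "d * grid \<le> s ^ 3"
  using mult_le_mono[OF d_le grid_le] by (simp add: power3_eq_cube power2_eq_square mult.assoc)

lemma vsize_new_verts: "vsize (list_val (map Atom new_verts)) \<le> 6 * s ^ 7"
proof -
  have "length new_verts = d * grid"
    using distinct_new_verts set_new_verts card_copies by (metis distinct_card)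
  moreover have "vsize (Atom x) \<le> 4 * s ^ 4" if "x \<in> set new_verts" for x
  proof (rule vsize_le_bound)
    obtain v i where "v \<in> verts H" "i < num_copies v" "x = v * grid + i"
      using \<open>x \<in> set new_verts\<close> unfolding set_new_verts by (auto simp: regular_def)
    then show "x \<le> bound" using copy_le_bound[of v i] num_copies_le_grid[of v] by simp
  qed
  ultimately have "vsize (list_val (map Atom new_verts)) \<le> 1 + s ^ 3 * (1 + 4 * s ^ 4)"
    using size_le by (intro vsize_list_le) auto
  also have "\<dots> \<le> 6 * s ^ 7"
    unfolding distrib_left mult_1_right mult.left_commute[of "s ^ 3"] powers(13)
    using powers by linarith
  finally show ?thesis .
qed

lemma share_phase_le:
  assumes "e \<in> edges H"
  shows "share e * (next_phase width e q period - q) \<le> bound"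
proof -
  have "share e * (next_phase width e q period - q) \<le> grid * period"
    using share_le_grid[OF assms] next_phase_le[of width e q period] by (intro mult_le_mono) auto
  then show ?thesis using grid_period_le_bound by simp
qed

lemma vsize_phase:
  assumes "e \<in> edges H" "q < period"
  shows "vsize (phase_val width (tables e) e period (share e) grid q) \<le> 18 * s ^ 5"
proof -
  let ?tup = "list_val (map (\<lambda>v. Cell (Atom (v * grid + q div width v)) (tables e v)) e)"
  have "vsize ?tup \<le> 1 + s * (1 + (1 + 4 * s ^ 4 + s))"
  proof -
    have "vsize (Cell (Atom (v * grid + q div width v)) (tables e v)) \<le> 1 + 4 * s ^ 4 + s"
      if "v \<in> set e" for v
      using edge_sizes(4)[OF assms(1) that] vsize_le_bound[OF copy_le_bound[of v "q div width v"]]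
        slot_less_grid[OF assms(2), of v] edge[OF assms(1)] that by auto
    then show ?thesis using edge_sizes(3)[OF assms(1)] by (intro vsize_list_le) auto
  qed
  also have "\<dots> \<le> 8 * s ^ 5" using powers by (simp add: distrib_left)
  finally have "vsize ?tup \<le> 8 * s ^ 5" .
  then show ?thesis
    using vsize_le_bound[OF share_phase_le[OF assms(1), of q]] vsize_le_bound[OF grid_period_le_bound]
      powers by (simp add: phase_val_def)
qed

text \<open>At most \<open>s\<close> edges have at most \<open>d * grid\<close>, hence
  \<open>s ^ 3\<close>, intervals each, and one new edge has size at most
  \<open>18 * s ^ 5\<close>.\<close>

lemma vsize_edges_vals: "vsize (list_val (edges_vals width tables share period grid es)) \<le> 20 * s ^ 9"
proof -
  let ?xs = "edges_vals width tables share period grid es"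
  have len: "length ?xs \<le> s ^ 4"
  proof -
    have "length ?xs = (\<Sum>e\<leftarrow>es. if share e = 0 then 0 else length (orbit_of e))"
      unfolding edges_vals_def orbit_of_def
      by (simp add: length_concat comp_def if_distrib cong: if_cong)
    also have "\<dots> \<le> (\<Sum>e\<leftarrow>es. d * grid)"
      using length_orbit_of_le es(2) by (intro sum_list_mono) auto
    also have "\<dots> \<le> s * s ^ 3" using length_es size_le by (simp add: sum_list_triv mult_le_mono)
    finally show ?thesis by (simp flip: power_Suc)
  qed
  have "vsize x \<le> 18 * s ^ 5" if x: "x \<in> set ?xs" for x
  proof -
    obtain e q where e: "e \<in> edges H" "0 < share e" "q \<in> set (orbit_of e)"
      "x = phase_val width (tables e) e period (share e) grid q"
      using x es(2) unfolding edges_vals_def orbit_of_def by (auto split: if_splits)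
    show ?thesis unfolding e(4) by (rule vsize_phase[OF e(1) orbit_of_less[OF e(1-3)]])
  qed
  then have "vsize (list_val ?xs) \<le> 1 + s ^ 4 * (1 + 18 * s ^ 5)" using len by (rule vsize_list_le)
  also have "\<dots> \<le> 20 * s ^ 9"
    unfolding distrib_left mult_1_right mult.left_commute[of "s ^ 4"] powers(14)
    using powers by linarith
  finally show ?thesis .
qed

text \<open>The calls account for 15 + 15 + 35 + 25 + 155 + 275 = 520 multiples of
  \<open>s ^ 5\<close>; the remainder covers the constantly many steps of the main expression
  itself.\<close>

lemma wp_main:
  "wp prog budget_size [code] main_body (\<lambda>v n. v = new_code \<and> n \<le> 600 * s ^ 5)"
proof -
  let ?P = "s ^ 5"
  let ?em = "shared_val tables share es"
  have len_vs: "calls prog budget_size 0 [list_val (map Atom vs)] (Atom (length vs)) (15 * ?P)"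
    using calls_mono[OF calls_len[of "map Atom vs"]] length_vs s_le_bound powers(5,8) by simp
  have len_es: "calls prog budget_size 0 [weighted_val tables num den es] (Atom (length es)) (15 * ?P)"
    unfolding weighted_val_def
    using calls_mono[OF calls_len[of "map f es" for f]] length_es s_le_bound powers(5,8) by simp
  have shares: "calls prog budget_size 10 [weighted_val tables num den es, Atom grid, Atom grid] ?em
      (35 * ?P)"
  proof (rule calls_mono[OF calls_shares])
    show "\<forall>e\<in>set (butlast es). share e = num e * grid div den e" using share_butlast by simp
    show "share (last es) = grid - (\<Sum>e\<leftarrow>butlast es. share e)" by (rule share_last)
    show "\<forall>e\<in>set es. num e * grid \<le> bound"
    proof
      fix e assume "e \<in> set es"
      then show "num e * grid \<le> bound"
        using le_boundI[of "num e" grid 1] num_less[of e] period_pos es(2) by simp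
    qed
    show "vsize ?em \<le> budget_size" using vsize_shared powers(3) by linarith
    show "30 * length es + 5 \<le> 35 * ?P" using length_es powers(5,8) by linarith
  qed
  have fact: "calls prog budget_size 11 [Atom grid] (Atom period) (25 * ?P)"
    unfolding period_def
  proof (rule calls_mono[OF calls_fact])
    show "fact grid \<le> bound" using period_le_bound by (simp add: period_def)
    show "20 * grid + 5 \<le> 25 * ?P" using grid_le powers(6,8) by linarith
  qed
  have lengths: "\<forall>e\<in>set es. length e \<le> s" using edge_sizes(3) es(2) by simp
  have verts: "calls prog budget_size 9 [list_val (map Atom vs), ?em, Atom grid]
      (list_val (map Atom new_verts)) (155 * ?P)"
    unfolding new_verts_def load_share[symmetric]
  proof (rule calls_mono[OF calls_verts[OF lengths s_le_bound]])
    show "\<forall>v. load share es v \<le> grid" using num_copies_le_grid by (simp add: load_share)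
    show "grid \<le> bound" by (rule grid_le_bound)
    show "\<forall>v\<in>set vs. v * grid + load share es v \<le> bound"
      using copy_le_bound num_copies_le_grid vs by (simp add: load_share)
    show "vsize (list_val (map Atom (concat (map (\<lambda>v. map (\<lambda>i. v * grid + i)
        (rev [0..<load share es v])) vs)))) \<le> budget_size"
      using vsize_new_verts powers(4) unfolding new_verts_def load_share by linarith
    have "(30 * grid + (30 * s + 40) * length es + 50) * length vs + 5
        \<le> (30 * s ^ 2 + (30 * s + 40) * s + 50) * s + 5"
      using grid_le length_es length_vs by (intro add_mono mult_le_mono) auto
    also have "\<dots> = 60 * s ^ 3 + 40 * s ^ 2 + 50 * s + 5"
      by (simp add: algebra_simps power2_eq_square power3_eq_cube)
    also have "\<dots> \<le> 155 * ?P" using powers(5-8) by linarith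
    finally show "(30 * grid + (30 * s + 40) * length es + 50) * length vs + 5 \<le> 155 * ?P" .
  qed
  have edges: "calls prog budget_size 7 [?em, ?em, Atom period, Atom grid]
      (list_val (edges_vals width tables share period grid es)) (275 * ?P)"
  proof -
    have width_eq: "width = (\<lambda>v. period div load share es v)"
      by (simp add: fun_eq_iff width_def load_share)
    have "calls prog budget_size 7 [?em, ?em, Atom period, Atom grid]
      (list_val (edges_vals (\<lambda>v. period div load share es v) tables share period grid es)) (275 * ?P)"
    proof (rule calls_mono[OF calls_edges[OF lengths s_le_bound, where K = "s ^ 3"]], fold width_eq)
      show "\<forall>v. load share es v \<le> bound"
        using num_copies_le_grid grid_le_bound by (auto simp: load_share intro: order_trans)
      show "grid * period \<le> bound" by (rule grid_period_le_bound)
      show "period \<le> bound" by (rule period_le_bound)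
      show "set es \<subseteq> set es" ..
      show "vsize (list_val (edges_vals width tables share period grid es)) \<le> budget_size"
        using vsize_edges_vals by linarith
      fix e assume e: "e \<in> set es"
      then have e': "e \<in> edges H" using es(2) by simp
      show "vsize (width_val width (tables e) e) \<le> budget_size"
        using vsize_widths[OF e'] powers(3) by linarith
      assume pos: "0 < share e"
      interpret phases width e period using e' pos by (rule phases_edge)
      show "length (orbit (\<lambda>r. next_phase width e r period) period 0) \<le> s ^ 3"
        using length_orbit_of_le[OF e' pos] size_le unfolding orbit_of_def by linarith
      fix r assume r: "r < period"
      show "r < next_phase width e r period \<and> share e * (next_phase width e r period - r) \<le> bound"
        using nxt_gt[OF r] share_phase_le[OF e'] by simp
      fix v assume v: "v \<in> set e"
      have "Suc (r div width v) * width v \<le> bound \<and> v * grid + r div width v \<le> bound"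
        using slot_end_le[OF r v] period_le_bound copy_le_bound[of v] slot_less_grid[OF r, of v]
          edge[OF e'] v by (auto intro: order_trans less_imp_le)
      then show "Suc (r div (period div load share es v)) * (period div load share es v) \<le> bound
          \<and> v * grid + r div (period div load share es v) \<le> bound"
        unfolding load_share width_def .
    next
      have "((60 * s + 60) * s ^ 3 + ((30 * s + 40) * length es + 30) * s + 50) * length es + 5
          \<le> ((60 * s + 60) * s ^ 3 + ((30 * s + 40) * s + 30) * s + 50) * s + 5"
        using length_es by (intro add_mono mult_le_mono) auto
      also have "\<dots> = 60 * s ^ 5 + 90 * s ^ 4 + 40 * s ^ 3 + 30 * s ^ 2 + 50 * s + 5"
        by algebra
      \<comment> \<open>275 = 60 + 90 + 40 + 30 + 50 + 5, the dominant part being the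
        \<open>s ^ 3\<close> intervals of each edge, visited at linear cost.\<close>
      also have "\<dots> \<le> 275 * ?P" using powers(2,5-8) by linarith
      finally show "((60 * s + 60) * s ^ 3 + ((30 * s + 40) * length es + 30) * s + 50) * length es + 5
          \<le> 275 * ?P" .
    qed
    then show ?thesis by (simp only: width_eq[symmetric])
  qed
  have size: "vsize new_code \<le> budget_size"
    using vsize_new_verts vsize_edges_vals vsize_labels powers by (simp add: new_code_def)
  then have size': "vsize (Cell (Atom (num_labels H))
      (list_val (edges_vals width tables share period grid es))) \<le> budget_size"
    by (simp add: new_code_def)
  have "vsize (Atom (length vs * length es)) \<le> budget_size"
    unfolding grid_length[symmetric] by (rule atom_size[OF grid_le_bound])
  then have "wp prog budget_size
      [Cell (list_val (map Atom vs)) (Cell (Atom (num_labels H)) (weighted_val tables num den es))]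
      main_body (\<lambda>v n. v = new_code \<and> n \<le> 600 * ?P)"
    using size size' powers(8)
    by (auto simp: main_body_def new_code_def grid_length[symmetric]
        intro!: with_callI[OF len_vs] with_callI[OF len_es] with_callI[OF shares] with_callI[OF fact]
          with_callI[OF verts] with_callI[OF edges])
  then show ?thesis by (simp only: code_def[symmetric])
qed

end

theorem theorem9p1:
  shows "\<exists>(F :: exp list) (main :: exp) (p :: nat poly) (C :: nat).
    \<forall>(d :: nat) (H :: nat hyper_unique_games) (x :: val). hug_instance d H \<longrightarrow>
      (\<exists>H' :: nat hyper_unique_games.
         hug_instance d H' \<and> num_labels H' = num_labels H \<and>
         card (verts H') \<le> C * (d * card (verts H) ^ 3 * card (edges H) ^ 3) \<and>
         \<bar>optimal_value H - optimal_value H'\<bar> \<le> 1 / real (card (verts H)) \<and>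
         (\<forall>v\<in>verts H'. measure_pmf.prob (weight H') {e. v \<in> set e}
            = real d / real (card (verts H'))) \<and>
         (encodes x H \<longrightarrow>
            (\<exists>y t. eval F [x] main y t \<and> t \<le> poly p (vsize x) \<and> encodes y H')))"
proof (intro exI[of _ prog] exI[of _ main_body] exI[of _ "monom 18000 14"] exI[of _ 1] allI impI)
  fix d :: nat and H :: "nat hyper_unique_games" and x :: val
  assume H: "hug_instance d H"
  have regular: "hug_instance d G \<and> num_labels G = num_labels H \<and>
      card (verts G) \<le> 1 * (d * card (verts H) ^ 3 * card (edges H) ^ 3) \<and>
      \<bar>optimal_value H - optimal_value G\<bar> \<le> 1 / real (card (verts H)) \<and>
      (\<forall>v\<in>verts G. measure_pmf.prob (weight G) {e. v \<in> set e} = real d / real (card (verts G)))"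
    if e0: "e0 \<in> edges H" and G: "G = regularization.regular H e0" for e0 G
  proof -
    interpret regularization d H e0 using H e0 by unfold_locales
    have "grid \<le> card (verts H) ^ 3 * card (edges H) ^ 3"
      unfolding grid_def using card_verts_pos card_edges_pos by (intro mult_le_mono self_le_power) auto
    then have "card (verts regular) \<le> 1 * (d * card (verts H) ^ 3 * card (edges H) ^ 3)"
      unfolding card_copies by (simp add: mult.assoc)
    moreover have "\<bar>optimal_value H - optimal_value regular\<bar> \<le> 1 / real (card (verts H))"
      using optimal_value_regular_ge optimal_value_regular_le by linarith
    ultimately show ?thesis
      unfolding G using instance_regular degree_regular by (simp add: regular_def)
  qed
  let ?good = "\<lambda>G. hug_instance d G \<and> num_labels G = num_labels H \<and>
      card (verts G) \<le> 1 * (d * card (verts H) ^ 3 * card (edges H) ^ 3) \<and>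
      \<bar>optimal_value H - optimal_value G\<bar> \<le> 1 / real (card (verts H)) \<and>
      (\<forall>v\<in>verts G. measure_pmf.prob (weight G) {e. v \<in> set e} = real d / real (card (verts G))) \<and>
      (encodes x H \<longrightarrow> (\<exists>y t. eval prog [x] main_body y t \<and>
         t \<le> poly (monom 18000 14) (vsize x) \<and> encodes y G))"
  show "\<exists>G. ?good G"
  \<comment> \<open>Without a code, for instance with irrational weights, any edge may absorb the
    rounding loss. With a code it must be the last listed edge, so the new instance depends on
    \<open>x\<close>.\<close>
  proof (cases "encodes x H")
    case False
    obtain e0 where "e0 \<in> edges H"
      using H set_pmf_not_empty[of "weight H"] unfolding hug_instance_def by blast
    from regular[OF this refl] False show ?thesis by blast
  next
    case True
    then obtain vs es num den where enc: "distinct vs" "set vs = verts H" "distinct es"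
      "set es = edges H"
      "\<forall>e\<in>edges H. 0 < den e \<and> pmf (weight H) e = real (num e) / real (den e)"
      and x: "x = Cell (list_val (map Atom vs)) (Cell (Atom (num_labels H)) (list_val
              (map (\<lambda>e. Cell
                 (list_val (map (\<lambda>v. Cell (Atom v)
                    (list_val (map (\<lambda>a. Atom (perm H e v a)) [0..<num_labels H]))) e))
                 (Cell (Atom (num e)) (Atom (den e)))) es)))"
      unfolding encodes_def by blast
    interpret encoded d H vs es num den using H enc by unfold_locales
    have code: "code = x"
      by (simp add: x code_def weighted_val_def table_val_def tables_def)
    obtain n t where t: "n \<le> 600 * vsize x ^ 5" "t \<le> n * (30 * vsize x ^ 9)"
      "eval prog [x] main_body new_code t"
      using wp_sound[OF two_le _ wp_main] powers unfolding code by fastforce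
    \<comment> \<open>The product of the step bound and the size bound gives the polynomial: 600 *
      30 = 18000 and 5 + 9 = 14.\<close>
    have "t \<le> 600 * vsize x ^ 5 * (30 * vsize x ^ 9)"
      using t(1,2) by (meson mult_le_mono1 order_trans)
    then have "t \<le> poly (monom 18000 14) (vsize x)"
      by (simp add: poly_monom mult.left_commute flip: power_add)
    then show ?thesis
      using regular[OF e0 refl] encodes_new_code t(3) by blast
  qed
qed

end
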